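(* Let $k$ be a field and $Q$ a finite quiver without sinks. Then the injective Leavitt complex $\mathcal{I}^{\bullet}$ of $Q$ is an acyclic complex, i.e. $H^l(\mathcal{I}^{\bullet})=0$ for every $l\in\mathbb{Z}$.
   Context: Quivers and $A$. $k$ is a field and $Q=(Q_0,Q_1;s,t)$ is a finite quiver without sinks: $Q_0$ is a finite set of vertices, $Q_1$ a finite set of arrows, $s,t:Q_1\to Q_0$ give starting and terminating vertices, and every vertex is the start of at least one arrow. A path of length $n\geq 1$ is a sequence $p=\alpha_n\cdots\alpha_1$ of arrows with $t(\alpha_j)=s(\alpha_{j+1})$ for $1\le j\le n-1$; $l(p)=n$, $s(p)=s(\alpha_1)$, $t(p)=t(\alpha_n)$. Each vertex $i$ has a trivial path $e_i$ of length $0$ with $s(e_i)=t(e_i)=i$. In the path algebra $kQ$ the product $pq$ of paths is the concatenation (first $q$, then $p$) if $s(p)=t(q)$, and $0$ otherwise. $J$ is the two-sided ideal of $kQ$ generated by arrows; $A=kQ/J^2$ has $k$-basis $\{e_i\}_{i\in Q_0}\cup Q_1$. Special arrows and admissible pairs. For each vertex $i$ fix one arrow starting at $i$, called the special arrow starting at $i$. For a special arrow $\alpha$ put $S(\alpha)=\{\beta\in Q_1\mid s(\beta)=s(\alpha),\ \beta\ne\alpha\}$. A pair $(p,q)$ of paths $p=\alpha_m\cdots\alpha_1$, $q=\beta_n\cdots\beta_1$ with $m,n\ge 1$ is admissible if $t(p)=t(q)$ and either $\alpha_m\ne\beta_n$, or $\alpha_m=\beta_n$ is not special; moreover for every path $r$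 the pairs $(r,e_{t(r)})$ and $(e_{t(r)},r)$ are admissible. For $i\in Q_0$, $l\in\mathbb{Z}$ let $\mathbf{B}^l_i$ be the set of admissible pairs $(p,q)$ with $l(q)-l(p)=l$ and $s(q)=i$. Injective modules. $I_i=\mathrm{Hom}_k(e_iA,k)$ (a left $A$-module), with basis $\{e_i^{\sharp}\}\cup\{\alpha^{\sharp}\mid \alpha\in Q_1,\ t(\alpha)=i\}$ dual to the basis $\{e_i\}\cup\{\alpha\mid t(\alpha)=i\}$ of $e_iA$. For a set $X$ and module $M$, $M^{(X)}=\bigoplus_{x\in X}M\zeta_x$ is the coproduct of copies of $M$, $m\zeta_x$ being the element $m$ in the copy indexed by $x$. Truncation. For $p=\alpha_n\cdots\alpha_1$ with $n\ge2$: $\widehat{p}=\alpha_{n-1}\cdots\alpha_1$; for an arrow $\alpha$: $\widehat{\alpha}=e_{s(\alpha)}$. Injective Leavitt complex. $\mathcal{I}^{\bullet}=(\mathcal{I}^l,\partial^l)_{l\in\mathbb{Z}}$ has $\mathcal{I}^l=\bigoplus_{i\in Q_0}I_i^{(\mathbf{B}^l_i)}$ and, for $i\in Q_0$, $(p,q)\in\mathbf{B}^l_i$ and $\alpha\in Q_1$ with $t(\alpha)=i$: $\partial^l(e_i^{\sharp}\zeta_{(p,q)})=0$; $\partial^l(\alpha^{\sharp}\zeta_{(p,q)})=e_{s(\alpha)}^{\sharp}\zeta_{(\widehat{p},e_{s(\alpha)})}-\sum_{\beta\in S(\alpha)}e_{s(\alpha)}^{\sharp}\zeta_{(\beta\widehat{p},\beta)}$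 if $q=e_i$, $p=\alpha\widehat{p}$ and $\alpha$ is special; and $\partial^l(\alpha^{\sharp}\zeta_{(p,q)})=e_{s(\alpha)}^{\sharp}\zeta_{(p,q\alpha)}$ otherwise. *)

theory Defs
  imports
    "Graph_Theory.Arc_Walk"
    "HOL-Algebra.QuotRing"
    "HOL-Algebra.Ideal_Product"
    "HOL-Algebra.Elementary_Groups"
    "HOL-Algebra.Module"
begin

section \<open>Complexes of left modules\<close>

text \<open>The library locale for modules requires a commutative base ring, so left modules over a
  general ring are introduced here. They use the library's module record; its fields for
  multiplication and unit are irrelevant.\<close>

locale left_module = R?: ring R + M?: abelian_group M
  for R :: "('r, 'c) ring_scheme" and M :: "('r, 'm, 'd) module_scheme" +
  assumes lsmult_closed: "\<lbrakk>a \<in> carrier R; x \<in> carrier M\<rbrakk> \<Longrightarrow> a \<odot>\<^bsub>M\<^esub> x \<in> carrier M"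
    and lsmult_l_distr: "\<lbrakk>a \<in> carrier R; b \<in> carrier R; x \<in> carrier M\<rbrakk>
      \<Longrightarrow> (a \<oplus>\<^bsub>R\<^esub> b) \<odot>\<^bsub>M\<^esub> x = a \<odot>\<^bsub>M\<^esub> x \<oplus>\<^bsub>M\<^esub> b \<odot>\<^bsub>M\<^esub> x"
    and lsmult_r_distr: "\<lbrakk>a \<in> carrier R; x \<in> carrier M; y \<in> carrier M\<rbrakk>
      \<Longrightarrow> a \<odot>\<^bsub>M\<^esub> (x \<oplus>\<^bsub>M\<^esub> y) = a \<odot>\<^bsub>M\<^esub> x \<oplus>\<^bsub>M\<^esub> a \<odot>\<^bsub>M\<^esub> y"
    and lsmult_assoc: "\<lbrakk>a \<in> carrier R; b \<in> carrier R; x \<in> carrier M\<rbrakk>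
      \<Longrightarrow> (a \<otimes>\<^bsub>R\<^esub> b) \<odot>\<^bsub>M\<^esub> x = a \<odot>\<^bsub>M\<^esub> (b \<odot>\<^bsub>M\<^esub> x)"
    and lsmult_one: "x \<in> carrier M \<Longrightarrow> \<one>\<^bsub>R\<^esub> \<odot>\<^bsub>M\<^esub> x = x"

definition left_module_hom ::
    "('r, 'c) ring_scheme \<Rightarrow> ('r, 'm) module \<Rightarrow> ('r, 'n) module \<Rightarrow> ('m \<Rightarrow> 'n) set" where
  "left_module_hom R M N = {h \<in> carrier M \<rightarrow> carrier N.
     (\<forall>x\<in>carrier M. \<forall>y\<in>carrier M. h (x \<oplus>\<^bsub>M\<^esub> y) = h x \<oplus>\<^bsub>N\<^esub> h y) \<and>
     (\<forall>a\<in>carrier R. \<forall>x\<in>carrier M. h (a \<odot>\<^bsub>M\<^esub> x) = a \<odot>\<^bsub>N\<^esub> h x)}"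

definition cochain_complex ::
    "('r, 'c) ring_scheme \<Rightarrow> (int \<Rightarrow> ('r, 'm) module) \<Rightarrow> (int \<Rightarrow> 'm \<Rightarrow> 'm) \<Rightarrow> bool" where
  "cochain_complex R M d \<longleftrightarrow>
     (\<forall>l. left_module R (M l)) \<and>
     (\<forall>l. d l \<in> left_module_hom R (M l) (M (l + 1))) \<and>
     (\<forall>l. \<forall>x\<in>carrier (M l). d (l + 1) (d l x) = \<zero>\<^bsub>M (l + 2)\<^esub>)"

text \<open>The underlying additive group of $H^l$, written as a group record with the library's
  quotient.\<close>

definition cohomology ::
    "(int \<Rightarrow> ('r, 'm) module) \<Rightarrow> (int \<Rightarrow> 'm \<Rightarrow> 'm) \<Rightarrow> int \<Rightarrow> 'm set monoid" where
  "cohomology M d l =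
     (add_monoid (M l))\<lparr>carrier := a_kernel (M l) (M (l + 1)) (d l)\<rparr>
       Mod (d (l - 1) ` carrier (M (l - 1)))"

definition acyclic_complex ::
    "('r, 'c) ring_scheme \<Rightarrow> (int \<Rightarrow> ('r, 'm) module) \<Rightarrow> (int \<Rightarrow> 'm \<Rightarrow> 'm) \<Rightarrow> bool" where
  "acyclic_complex R M d \<longleftrightarrow>
     cochain_complex R M d \<and> (\<forall>l. trivial_group (cohomology M d l))"

definition coproduct :: "'i set \<Rightarrow> ('i \<Rightarrow> ('r, 'm) module) \<Rightarrow> ('r, 'i \<Rightarrow> 'm) module" where
  "coproduct I M =
     \<lparr>carrier = {x \<in> (\<Pi>\<^sub>E i\<in>I. carrier (M i)). finite {i \<in> I. x i \<noteq> \<zero>\<^bsub>M i\<^esub>}},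
      mult = undefined, one = undefined,
      zero = (\<lambda>i\<in>I. \<zero>\<^bsub>M i\<^esub>),
      add = (\<lambda>x y. \<lambda>i\<in>I. x i \<oplus>\<^bsub>M i\<^esub> y i),
      smult = (\<lambda>a x. \<lambda>i\<in>I. a \<odot>\<^bsub>M i\<^esub> x i)\<rparr>"

definition coproduct_inj ::
    "'i set \<Rightarrow> ('i \<Rightarrow> ('r, 'm) module) \<Rightarrow> 'i \<Rightarrow> 'm \<Rightarrow> ('i \<Rightarrow> 'm)" where
  "coproduct_inj I M j m = (\<lambda>i\<in>I. if i = j then m else \<zero>\<^bsub>M i\<^esub>)"


section \<open>Paths and the path algebra\<close>

text \<open>A finite quiver is a finite directed multigraph of \<^locale>\<open>fin_digraph\<close>. A path is a pair of
  its starting vertex and the list of its arrows in the order in which they are traversed: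
  $\alpha_n\cdots\alpha_1$ is \<open>(s(\<alpha>\<^sub>1), [\<alpha>\<^sub>1, \<dots>, \<alpha>\<^sub>n])\<close> and $e_i$ is \<open>(i, [])\<close>. In particular the
  leftmost arrow of the mathematical notation is the last one in the list.\<close>

type_synonym ('v, 'a) qpath = "'v \<times> 'a list"

definition no_sinks :: "('v, 'a) pre_digraph \<Rightarrow> bool" where
  "no_sinks Q \<longleftrightarrow> (\<forall>i\<in>verts Q. \<exists>\<alpha>\<in>arcs Q. tail Q \<alpha> = i)"

definition src :: "('v, 'a) qpath \<Rightarrow> 'v" where
  "src p = fst p"

definition tgt :: "('v, 'a) pre_digraph \<Rightarrow> ('v, 'a) qpath \<Rightarrow> 'v" where
  "tgt Q p = pre_digraph.awlast Q (fst p) (snd p)"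

definition len :: "('v, 'a) qpath \<Rightarrow> nat" where
  "len p = length (snd p)"

definition paths :: "('v, 'a) pre_digraph \<Rightarrow> ('v, 'a) qpath set" where
  "paths Q = {p. pre_digraph.awalk Q (src p) (snd p) (tgt Q p)}"

definition triv_path :: "'v \<Rightarrow> ('v, 'a) qpath" where
  "triv_path i = (i, [])"

definition arrow_path :: "('v, 'a) pre_digraph \<Rightarrow> 'a \<Rightarrow> ('v, 'a) qpath" where
  "arrow_path Q \<alpha> = (tail Q \<alpha>, [\<alpha>])"

text \<open>The path $pq$: first $q$, then $p$; meaningful if $s(p) = t(q)$.\<close>

definition path_comp :: "('v, 'a) qpath \<Rightarrow> ('v, 'a) qpath \<Rightarrow> ('v, 'a) qpath" where
  "path_comp p q = (src q, snd q @ snd p)"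

text \<open>For $p$ of positive length, the path $\widehat p$ (without the last traversed arrow).\<close>

definition trunc :: "('v, 'a) qpath \<Rightarrow> ('v, 'a) qpath" where
  "trunc p = (fst p, butlast (snd p))"

text \<open>$kQ$: finitely supported functions on the set of paths.\<close>

definition path_algebra :: "('v, 'a) pre_digraph \<Rightarrow> (('v, 'a) qpath \<Rightarrow> 'k::field) ring" where
  "path_algebra Q =
     \<lparr>carrier = {f. finite {p. f p \<noteq> 0} \<and> {p. f p \<noteq> 0} \<subseteq> paths Q},
      mult = (\<lambda>f g r. \<Sum>(p, q) | f p \<noteq> 0 \<and> g q \<noteq> 0 \<and> src p = tgt Q q \<and> path_comp p q = r.
                f p * g q),
      one = (\<lambda>p. if p \<in> paths Q \<and> len p = 0 then 1 else 0),
      zero = (\<lambda>p. 0),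
      add = (\<lambda>f g p. f p + g p)\<rparr>"

definition path_elem :: "('v, 'a) qpath \<Rightarrow> (('v, 'a) qpath \<Rightarrow> 'k::field)" where
  "path_elem p = (\<lambda>q. if q = p then 1 else 0)"

definition arrow_ideal :: "('v, 'a) pre_digraph \<Rightarrow> (('v, 'a) qpath \<Rightarrow> 'k::field) set" where
  "arrow_ideal Q = genideal (path_algebra Q) ((\<lambda>\<alpha>. path_elem (arrow_path Q \<alpha>)) ` arcs Q)"

definition arrow_ideal_sq :: "('v, 'a) pre_digraph \<Rightarrow> (('v, 'a) qpath \<Rightarrow> 'k::field) set" where
  "arrow_ideal_sq Q = ideal_prod (path_algebra Q) (arrow_ideal Q) (arrow_ideal Q)"


section \<open>The algebra $A = kQ/J^2$ and its indecomposable injective modules\<close>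

type_synonym ('v, 'a, 'k) rsz = "(('v, 'a) qpath \<Rightarrow> 'k) set"

definition rsz_algebra :: "('v, 'a) pre_digraph \<Rightarrow> ('v, 'a, 'k::field) rsz ring" where
  "rsz_algebra Q = path_algebra Q Quot arrow_ideal_sq Q"

definition rsz_class ::
    "('v, 'a) pre_digraph \<Rightarrow> (('v, 'a) qpath \<Rightarrow> 'k::field) \<Rightarrow> ('v, 'a, 'k) rsz" where
  "rsz_class Q f = arrow_ideal_sq Q +>\<^bsub>path_algebra Q\<^esub> f"

definition rsz_vertex :: "('v, 'a) pre_digraph \<Rightarrow> 'v \<Rightarrow> ('v, 'a, 'k::field) rsz" where
  "rsz_vertex Q i = rsz_class Q (path_elem (triv_path i))"

definition rsz_arrow :: "('v, 'a) pre_digraph \<Rightarrow> 'a \<Rightarrow> ('v, 'a, 'k::field) rsz" where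
  "rsz_arrow Q \<alpha> = rsz_class Q (path_elem (arrow_path Q \<alpha>))"

text \<open>The image of the scalar $c$ under the structure map $k \to A$. All $k$-vector space structures
  below are obtained by restricting along this map.\<close>

definition rsz_scalar :: "('v, 'a) pre_digraph \<Rightarrow> 'k::field \<Rightarrow> ('v, 'a, 'k) rsz" where
  "rsz_scalar Q c = rsz_class Q (\<lambda>p. c * \<one>\<^bsub>path_algebra Q\<^esub> p)"

definition right_proj :: "('v, 'a) pre_digraph \<Rightarrow> 'v \<Rightarrow> ('v, 'a, 'k::field) rsz set" where
  "right_proj Q i = (\<lambda>x. rsz_vertex Q i \<otimes>\<^bsub>rsz_algebra Q\<^esub> x) ` carrier (rsz_algebra Q)"

text \<open>$I_i = \mathrm{Hom}_k(e_iA, k)$ with the left action $(a\varphi)(x) = \varphi(xa)$.\<close>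

definition inj_module ::
    "('v, 'a) pre_digraph \<Rightarrow> 'v \<Rightarrow>
      (('v, 'a, 'k::field) rsz, ('v, 'a, 'k) rsz \<Rightarrow> 'k) module" where
  "inj_module Q i =
     \<lparr>carrier = {\<phi> \<in> extensional (right_proj Q i).
        (\<forall>x\<in>right_proj Q i. \<forall>y\<in>right_proj Q i. \<phi> (x \<oplus>\<^bsub>rsz_algebra Q\<^esub> y) = \<phi> x + \<phi> y) \<and>
        (\<forall>c. \<forall>x\<in>right_proj Q i. \<phi> (rsz_scalar Q c \<otimes>\<^bsub>rsz_algebra Q\<^esub> x) = c * \<phi> x)},
      mult = undefined, one = undefined,
      zero = (\<lambda>x\<in>right_proj Q i. 0),
      add = (\<lambda>\<phi> \<psi>. \<lambda>x\<in>right_proj Q i. \<phi> x + \<psi> x),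
      smult = (\<lambda>a \<phi>. \<lambda>x\<in>right_proj Q i. \<phi> (x \<otimes>\<^bsub>rsz_algebra Q\<^esub> a))\<rparr>"

definition right_proj_basis :: "('v, 'a) pre_digraph \<Rightarrow> 'v \<Rightarrow> ('v, 'a, 'k::field) rsz set" where
  "right_proj_basis Q i =
     insert (rsz_vertex Q i) (rsz_arrow Q ` {\<alpha> \<in> arcs Q. head Q \<alpha> = i})"

text \<open>The element $b^\sharp$ of the dual basis of $I_i$, for a basis element $b$ of $e_iA$.\<close>

definition dual_elem ::
    "('v, 'a) pre_digraph \<Rightarrow> 'v \<Rightarrow> ('v, 'a, 'k::field) rsz \<Rightarrow> (('v, 'a, 'k) rsz \<Rightarrow> 'k)" where
  "dual_elem Q i b = (THE \<phi>. \<phi> \<in> carrier (inj_module Q i) \<and>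
     (\<forall>c\<in>right_proj_basis Q i. \<phi> c = (if c = b then 1 else 0)))"

definition vertex_dual ::
    "('v, 'a) pre_digraph \<Rightarrow> 'v \<Rightarrow> (('v, 'a, 'k::field) rsz \<Rightarrow> 'k)" where
  "vertex_dual Q i = dual_elem Q i (rsz_vertex Q i)"


section \<open>The injective Leavitt complex\<close>

text \<open>\<open>sp i\<close> is the special arrow starting at the vertex \<open>i\<close>.\<close>

definition special_choice :: "('v, 'a) pre_digraph \<Rightarrow> ('v \<Rightarrow> 'a) \<Rightarrow> bool" where
  "special_choice Q sp \<longleftrightarrow> (\<forall>i\<in>verts Q. sp i \<in> arcs Q \<and> tail Q (sp i) = i)"

definition special :: "('v, 'a) pre_digraph \<Rightarrow> ('v \<Rightarrow> 'a) \<Rightarrow> 'a \<Rightarrow> bool" where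
  "special Q sp \<alpha> \<longleftrightarrow> \<alpha> \<in> arcs Q \<and> \<alpha> = sp (tail Q \<alpha>)"

definition siblings :: "('v, 'a) pre_digraph \<Rightarrow> 'a \<Rightarrow> 'a set" where
  "siblings Q \<alpha> = {\<beta> \<in> arcs Q. tail Q \<beta> = tail Q \<alpha> \<and> \<beta> \<noteq> \<alpha>}"

definition admissible ::
    "('v, 'a) pre_digraph \<Rightarrow> ('v \<Rightarrow> 'a) \<Rightarrow> ('v, 'a) qpath \<Rightarrow> ('v, 'a) qpath \<Rightarrow> bool" where
  "admissible Q sp p q \<longleftrightarrow> p \<in> paths Q \<and> q \<in> paths Q \<and>
     (q = triv_path (tgt Q p) \<or> p = triv_path (tgt Q q) \<or>
      len p \<ge> 1 \<and> len q \<ge> 1 \<and> tgt Q p = tgt Q q \<and>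
        (last (snd p) \<noteq> last (snd q) \<or>
         last (snd p) = last (snd q) \<and> \<not> special Q sp (last (snd p))))"

definition adm_pairs ::
    "('v, 'a) pre_digraph \<Rightarrow> ('v \<Rightarrow> 'a) \<Rightarrow> int \<Rightarrow> 'v \<Rightarrow> (('v, 'a) qpath \<times> ('v, 'a) qpath) set" where
  "adm_pairs Q sp l i =
     {(p, q). admissible Q sp p q \<and> int (len q) - int (len p) = l \<and> src q = i}"

type_synonym ('v, 'a, 'k) leavitt_elem =
  "'v \<Rightarrow> ('v, 'a) qpath \<times> ('v, 'a) qpath \<Rightarrow> ('v, 'a, 'k) rsz \<Rightarrow> 'k"

definition leavitt_copower ::
    "('v, 'a) pre_digraph \<Rightarrow> ('v \<Rightarrow> 'a) \<Rightarrow> int \<Rightarrow> 'v \<Rightarrow>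
      (('v, 'a, 'k::field) rsz,
       ('v, 'a) qpath \<times> ('v, 'a) qpath \<Rightarrow> ('v, 'a, 'k) rsz \<Rightarrow> 'k) module" where
  "leavitt_copower Q sp l i = coproduct (adm_pairs Q sp l i) (\<lambda>_. inj_module Q i)"

definition leavitt_module ::
    "('v, 'a) pre_digraph \<Rightarrow> ('v \<Rightarrow> 'a) \<Rightarrow> int \<Rightarrow>
      (('v, 'a, 'k::field) rsz, ('v, 'a, 'k) leavitt_elem) module" where
  "leavitt_module Q sp l = coproduct (verts Q) (leavitt_copower Q sp l)"

text \<open>The element $m\zeta_{(p,q)}$ of $\mathcal I^l$, for $(p,q)\in\mathbf B^l_i$ and $m \in I_i$
  with $i = s(q)$.\<close>

definition leavitt_zeta ::
    "('v, 'a) pre_digraph \<Rightarrow> ('v \<Rightarrow> 'a) \<Rightarrow> int \<Rightarrow>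
      (('v, 'a, 'k::field) rsz \<Rightarrow> 'k) \<Rightarrow> ('v, 'a) qpath \<Rightarrow> ('v, 'a) qpath \<Rightarrow>
      ('v, 'a, 'k) leavitt_elem" where
  "leavitt_zeta Q sp l m p q =
     coproduct_inj (verts Q) (leavitt_copower Q sp l) (src q)
       (coproduct_inj (adm_pairs Q sp l (src q)) (\<lambda>_. inj_module Q (src q)) (p, q) m)"

text \<open>The value $\partial^l(\alpha^\sharp\zeta_{(p,q)})$, an element of $\mathcal I^{l+1}$, for
  $(p,q)\in\mathbf B^l_i$ and $t(\alpha) = i$.\<close>

definition leavitt_diff_arrow ::
    "('v, 'a) pre_digraph \<Rightarrow> ('v \<Rightarrow> 'a) \<Rightarrow> int \<Rightarrow> 'a \<Rightarrow> ('v, 'a) qpath \<Rightarrow> ('v, 'a) qpath \<Rightarrow>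
      ('v, 'a, 'k::field) leavitt_elem" where
  "leavitt_diff_arrow Q sp l \<alpha> p q =
     (let j = tail Q \<alpha> in
      if len q = 0 \<and> len p \<ge> 1 \<and> last (snd p) = \<alpha> \<and> special Q sp \<alpha>
      then leavitt_zeta Q sp (l + 1) (vertex_dual Q j) (trunc p) (triv_path j)
        \<ominus>\<^bsub>leavitt_module Q sp (l + 1)\<^esub>
        (\<Oplus>\<^bsub>leavitt_module Q sp (l + 1)\<^esub>\<beta>\<in>siblings Q \<alpha>.
           leavitt_zeta Q sp (l + 1) (vertex_dual Q j)
             (path_comp (arrow_path Q \<beta>) (trunc p)) (arrow_path Q \<beta>))
      else leavitt_zeta Q sp (l + 1) (vertex_dual Q j) p (path_comp q (arrow_path Q \<alpha>)))"

text \<open>The \<open>k\<close>-linear extension. The coefficient of $\alpha^\sharp\zeta_{(p,q)}$ in \<open>x\<close> is the value of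
  the functional \<open>x i z\<close>, \<open>z = (p, q)\<close>, at $\alpha$; the basis elements $e_i^\sharp\zeta_{(p,q)}$ are sent to $0$
  and contribute no summand.\<close>

definition leavitt_diff ::
    "('v, 'a) pre_digraph \<Rightarrow> ('v \<Rightarrow> 'a) \<Rightarrow> int \<Rightarrow>
      ('v, 'a, 'k::field) leavitt_elem \<Rightarrow> ('v, 'a, 'k) leavitt_elem" where
  "leavitt_diff Q sp l x =
     (\<Oplus>\<^bsub>leavitt_module Q sp (l + 1)\<^esub>i\<in>verts Q.
      \<Oplus>\<^bsub>leavitt_module Q sp (l + 1)\<^esub>z\<in>{z \<in> adm_pairs Q sp l i. x i z \<noteq> \<zero>\<^bsub>inj_module Q i\<^esub>}.
      \<Oplus>\<^bsub>leavitt_module Q sp (l + 1)\<^esub>\<alpha>\<in>{\<alpha> \<in> arcs Q. head Q \<alpha> = i}.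
        rsz_scalar Q (x i z (rsz_arrow Q \<alpha>))
          \<odot>\<^bsub>leavitt_module Q sp (l + 1)\<^esub> leavitt_diff_arrow Q sp l \<alpha> (fst z) (snd z))"

end

theory Submission
  imports Defs
begin

text \<open>Elements of $A$ are determined by their coefficients at vertices and arrows, and
  $\<phi> \<in> I_i$ by its values on $e_i$ and on the arrows ending at $i$. The differential kills
  the $e_i^\<sharp>\<zeta>_z$ and has values in their span, so exactness means that it maps the span of
  the $\<alpha>^\<sharp>\<zeta>_z$ bijectively onto the span of the $e_i^\<sharp>\<zeta>_w$. The
  inverse sends $e_i^\<sharp>\<zeta>_{(p,q\<alpha>)}$ to $\<alpha>^\<sharp>\<zeta>_{(p,q)}$ and
  $e_j^\<sharp>\<zeta>_{(p,e_j)}$ to the sum of $\<alpha>^\<sharp>\<zeta>_{(\<alpha> p,e)}$ over all arrows $\<alpha>$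
  starting at $j$.\<close>

section \<open>The path algebra\<close>

text \<open>The sum over all arrows starting at j works by cancellation. The special arrow alone
  gives e_j^\<sharp>\<zeta>_{(p,e_j)} minus one term \<zeta>_{(\<beta> p,\<beta>)} for each sibling
  \<beta>. Each sibling falls under the ordinary rule and gives exactly that term back. The
  exceptional rule is forced: for special \<alpha> the pair (\<alpha> p, \<alpha>) is not
  admissible, so the ordinary rule would have no target there, whereas siblings of a special arrow
  are never special.

  Since the sets of admissible pairs may be infinite, the argument runs on coefficients. Each
  coefficient of \<partial> x is one coefficient of x or a difference of two. The second of the two
  is itself a coefficient of \<partial> x at a pair with trivial second path, so the system is
  triangular. Surjectivity also requires finite support of the preimage.

  Coefficients in A make sense only once J^2, which is defined as a product of generated ideals, is
  known to consist exactly of the combinations of paths of length at least 2.\<close>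

lemma tgt_conv: "tgt Q p = (if snd p = [] then fst p else head Q (last (snd p)))"
  by (simp add: tgt_def pre_digraph.awalk_verts_conv)

context wf_digraph
begin

lemma paths_Nil [simp]: "(v, []) \<in> paths G \<longleftrightarrow> v \<in> verts G"
  by (simp add: paths_def src_def tgt_def awalk_Nil_iff)

lemma paths_append:
  "(v, as @ bs) \<in> paths G \<longleftrightarrow> (v, as) \<in> paths G \<and> (tgt G (v, as), bs) \<in> paths G"
proof -
  have "awlast v (as @ bs) = awlast (awlast v as) bs"
    by (simp add: awalk_verts_conv)
  then show ?thesis
    by (simp add: paths_def src_def tgt_def awalk_append_iff)
qed

lemma paths_Cons [simp]:
  "(v, a # as) \<in> paths G \<longleftrightarrow> a \<in> arcs G \<and> tail G a = v \<and> (head G a, as) \<in> paths G"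
  by (auto simp: paths_def src_def tgt_def awalk_Cons_iff awalk_verts_conv)

lemma paths_snoc [simp]:
  "(v, as @ [b]) \<in> paths G \<longleftrightarrow> (v, as) \<in> paths G \<and> b \<in> arcs G \<and> tail G b = tgt G (v, as)"
  by (auto simp: paths_append)

lemma paths_fst: "(v, as) \<in> paths G \<Longrightarrow> v \<in> verts G"
  by (cases as) auto

lemma paths_tgt: "(v, as) \<in> paths G \<Longrightarrow> tgt G (v, as) \<in> verts G"
  using paths_append[of v as "[]"] by simp

end

section \<open>Cutting a path into two pieces\<close>

definition path_prefix :: "nat \<Rightarrow> ('v, 'a) qpath \<Rightarrow> ('v, 'a) qpath" where
  "path_prefix n r = (fst r, take n (snd r))"

text \<open>The starting vertex is chosen so that suffix and prefix are composable with composite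
  \<open>r\<close>, whether or not \<open>r\<close> is a path. The convolution identities then hold
  at every argument.\<close>

definition path_suffix :: "('v, 'a) pre_digraph \<Rightarrow> nat \<Rightarrow> ('v, 'a) qpath \<Rightarrow> ('v, 'a) qpath" where
  "path_suffix Q n r = (tgt Q (path_prefix n r), drop n (snd r))"

lemma len_prefix: "n \<le> len r \<Longrightarrow> len (path_prefix n r) = n"
  by (simp add: len_def path_prefix_def)

lemma len_suffix: "len (path_suffix Q n r) = len r - n"
  by (simp add: len_def path_suffix_def)

lemma prefix_prefix: "m \<le> n \<Longrightarrow> path_prefix m (path_prefix n r) = path_prefix m r"
  by (simp add: path_prefix_def min_def)

lemma suffix_suffix: "path_suffix Q m (path_suffix Q n r) = path_suffix Q (n + m) r"
proof -
  have "drop m (drop n (snd r)) = drop (n + m) (snd r)" by (simp add: add.commute)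
  then show ?thesis by (auto simp: path_suffix_def path_prefix_def tgt_conv take_add)
qed

lemma prefix_suffix:
  "path_prefix m (path_suffix Q n r) = path_suffix Q n (path_prefix (n + m) r)"
  by (simp add: path_suffix_def path_prefix_def min_def take_drop add.commute)

lemma suffix_0 [simp]: "path_suffix Q 0 r = r"
  by (simp add: path_suffix_def path_prefix_def tgt_conv)

lemma prefix_all: "path_prefix (len r) r = r"
  by (simp add: path_prefix_def len_def)

lemma carrier_path_algebra:
  "f \<in> carrier (path_algebra Q) \<longleftrightarrow> finite {p. f p \<noteq> 0} \<and> {p. f p \<noteq> 0} \<subseteq> paths Q"
  by (simp add: path_algebra_def)

text \<open>The composable factorisations of \<open>r\<close> are exactly its cuts, numbered by the
  length of the factor traversed first. Summing over all cut positions replaces an index set that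
  depends on \<open>f\<close> and \<open>g\<close> by one that depends on \<open>r\<close>
  only.\<close>

lemma mult_path_algebra:
  fixes f g :: "('v, 'a) qpath \<Rightarrow> 'k::field"
  assumes "f \<in> carrier (path_algebra Q)" "g \<in> carrier (path_algebra Q)"
  shows "(f \<otimes>\<^bsub>path_algebra Q\<^esub> g) r =
    (\<Sum>n\<le>len r. f (path_suffix Q n r) * g (path_prefix n r))"
proof -
  let ?S = "{(p, q). f p \<noteq> 0 \<and> g q \<noteq> 0 \<and> src p = tgt Q q \<and> path_comp p q = r}"
  let ?h = "\<lambda>n. (path_suffix Q n r, path_prefix n r)"
  let ?T = "{n\<in>{..len r}. f (path_suffix Q n r) \<noteq> 0 \<and> g (path_prefix n r) \<noteq> 0}"
  have inj: "inj_on ?h ?T"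
    by (rule inj_onI) (metis (mono_tags, lifting) Pair_inject atMost_iff len_prefix mem_Collect_eq)
  have S: "?S = ?h ` ?T"
  proof (intro equalityI subsetI)
    fix pq assume "pq \<in> ?S"
    then obtain p q where pq: "pq = (p, q)" "f p \<noteq> 0" "g q \<noteq> 0" "src p = tgt Q q"
      "path_comp p q = r" by auto
    then have "r = (fst q, snd q @ snd p)" by (simp add: path_comp_def src_def)
    then have "pq = ?h (len q)" "len q \<le> len r"
      using pq by (auto simp: path_suffix_def path_prefix_def src_def len_def prod_eq_iff)
    then show "pq \<in> ?h ` ?T" using pq by auto
  next
    fix pq assume "pq \<in> ?h ` ?T"
    then show "pq \<in> ?S"
      by (auto simp: path_suffix_def path_prefix_def path_comp_def src_def)
  qed
  have "(f \<otimes>\<^bsub>path_algebra Q\<^esub> g) r = (\<Sum>(p, q)\<in>?S. f p * g q)"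
    by (simp add: path_algebra_def)
  also have "\<dots> = (\<Sum>n\<in>?T. f (path_suffix Q n r) * g (path_prefix n r))"
    unfolding S sum.reindex[OF inj] by simp
  also have "\<dots> = (\<Sum>n\<le>len r. f (path_suffix Q n r) * g (path_prefix n r))"
    by (rule sum.mono_neutral_left) auto
  finally show ?thesis .
qed

text \<open>The scalar multiple c p. Ideals of a ring are not assumed stable under the field, so J^2
  has to be shown to contain every c p and not merely p.\<close>

definition path_monom :: "'k \<Rightarrow> ('v, 'a) qpath \<Rightarrow> ('v, 'a) qpath \<Rightarrow> 'k::field" where
  "path_monom c p = (\<lambda>q. if q = p then c else 0)"

lemma path_elem_monom: "path_elem p = path_monom 1 p"
  by (simp add: path_elem_def path_monom_def)

section \<open>Ring structure of the path algebra\<close>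

context wf_digraph
begin

abbreviation kQ :: "(('a, 'b) qpath \<Rightarrow> 'k::field) ring" where
  "kQ \<equiv> path_algebra G"

lemma path_monom_closed: "p \<in> paths G \<Longrightarrow> path_monom c p \<in> carrier kQ"
  by (auto simp: carrier_path_algebra path_monom_def split: if_splits intro: finite_subset[of _ "{p}"])

lemma path_monom_mult:
  fixes c d :: "'k::field"
  assumes "p \<in> paths G" "q \<in> paths G" "tgt G q = src p"
  shows "path_monom c p \<otimes>\<^bsub>kQ\<^esub> path_monom d q = path_monom (c * d) (path_comp p q)"
proof
  fix r
  let ?S = "{(p', q'). path_monom c p p' \<noteq> 0 \<and> path_monom d q q' \<noteq> 0 \<and> src p' = tgt G q'
    \<and> path_comp p' q' = r}"
  have "?S = (if c \<noteq> 0 \<and> d \<noteq> 0 \<and> path_comp p q = r then {(p, q)} else {})"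
    using assms(3) by (auto simp: path_monom_def split: if_splits)
  then show "(path_monom c p \<otimes>\<^bsub>kQ\<^esub> path_monom d q) r = path_monom (c * d) (path_comp p q) r"
    by (simp add: path_algebra_def path_monom_def)
qed

lemma path_algebra_mult_closed:
  fixes f g :: "('a, 'b) qpath \<Rightarrow> 'k::field"
  assumes f: "f \<in> carrier kQ" and g: "g \<in> carrier kQ"
  shows "f \<otimes>\<^bsub>kQ\<^esub> g \<in> carrier kQ"
proof -
  let ?F = "{p. f p \<noteq> 0}" and ?G = "{p. g p \<noteq> 0}"
  have *: "\<exists>p\<in>?F. \<exists>q\<in>?G. src p = tgt G q \<and> path_comp p q = r"
    if "(f \<otimes>\<^bsub>kQ\<^esub> g) r \<noteq> 0" for r
  proof -
    have "(\<Sum>(p, q) | f p \<noteq> 0 \<and> g q \<noteq> 0 \<and> src p = tgt G q \<and> path_comp p q = r. f p * g q) \<noteq> 0"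
      using that by (simp add: path_algebra_def)
    then obtain pq where "pq \<in> {(p, q). f p \<noteq> 0 \<and> g q \<noteq> 0 \<and> src p = tgt G q \<and> path_comp p q = r}"
      by (metis (no_types, lifting) sum.neutral)
    then show ?thesis by auto
  qed
  have "{r. (f \<otimes>\<^bsub>kQ\<^esub> g) r \<noteq> 0} \<subseteq> (\<lambda>(p, q). path_comp p q) ` (?F \<times> ?G)"
  proof
    fix r assume "r \<in> {r. (f \<otimes>\<^bsub>kQ\<^esub> g) r \<noteq> 0}"
    then obtain p q where "p \<in> ?F" "q \<in> ?G" "path_comp p q = r" using * by blast
    then show "r \<in> (\<lambda>(p, q). path_comp p q) ` (?F \<times> ?G)" by (intro image_eqI[of _ _ "(p, q)"]) auto
  qed
  moreover have "finite (?F \<times> ?G)" using f g by (simp add: carrier_path_algebra)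
  ultimately have "finite {r. (f \<otimes>\<^bsub>kQ\<^esub> g) r \<noteq> 0}" by (meson finite_imageI finite_subset)
  moreover have "r \<in> paths G" if r: "(f \<otimes>\<^bsub>kQ\<^esub> g) r \<noteq> 0" for r
  proof -
    obtain p q where "p \<in> ?F" "q \<in> ?G" "src p = tgt G q" "path_comp p q = r" using *[OF r] by blast
    then have "p \<in> paths G" "q \<in> paths G" "r = (fst q, snd q @ snd p)" "fst p = tgt G q"
      using f g by (auto simp: carrier_path_algebra path_comp_def src_def)
    then show ?thesis by (metis paths_append prod.collapse)
  qed
  ultimately show ?thesis by (auto simp: carrier_path_algebra)
qed

lemma path_algebra_add_closed:
  fixes f g :: "('a, 'b) qpath \<Rightarrow> 'k::field"
  assumes f: "f \<in> carrier kQ" and g: "g \<in> carrier kQ"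
  shows "f \<oplus>\<^bsub>kQ\<^esub> g \<in> carrier kQ"
proof -
  have "{p. f p + g p \<noteq> 0} \<subseteq> {p. f p \<noteq> 0} \<union> {p. g p \<noteq> 0}" by auto
  then have "finite {p. f p + g p \<noteq> 0}" "{p. f p + g p \<noteq> 0} \<subseteq> paths G"
    using f g by (auto simp: carrier_path_algebra intro: finite_subset)
  then show ?thesis by (simp add: path_algebra_def)
qed

lemma path_algebra_zero_closed: "\<zero>\<^bsub>kQ\<^esub> \<in> carrier kQ"
  by (simp add: path_algebra_def)

lemma path_algebra_scale_closed:
  fixes f :: "('a, 'b) qpath \<Rightarrow> 'k::field"
  assumes f: "f \<in> carrier kQ"
  shows "(\<lambda>p. c * f p) \<in> carrier kQ"
proof -
  have "{p. c * f p \<noteq> 0} \<subseteq> {p. f p \<noteq> 0}" by auto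
  then show ?thesis
    using f by (auto simp: carrier_path_algebra intro: finite_subset)
qed

text \<open>Both bracketings sum over the ways of cutting \<open>r\<close> at two positions into
  three pieces. The left one is indexed by the first position and the gap, the right one by the two
  positions themselves.\<close>

lemma path_algebra_mult_assoc:
  fixes f g h :: "('a, 'b) qpath \<Rightarrow> 'k::field"
  assumes f: "f \<in> carrier kQ" and g: "g \<in> carrier kQ" and h: "h \<in> carrier kQ"
  shows "(f \<otimes>\<^bsub>kQ\<^esub> g) \<otimes>\<^bsub>kQ\<^esub> h = f \<otimes>\<^bsub>kQ\<^esub> (g \<otimes>\<^bsub>kQ\<^esub> h)"
proof
  fix r :: "('a, 'b) qpath"
  let ?N = "len r"
  let ?t = "\<lambda>(n::nat) (m::nat). f (path_suffix G n r) * g (path_suffix G m (path_prefix n r)) * h (path_prefix m r)"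
  let ?B = "Sigma {..?N} (\<lambda>n. {..n})" and ?C = "Sigma {..?N} (\<lambda>m. {..?N - m})"
  have "((f \<otimes>\<^bsub>kQ\<^esub> g) \<otimes>\<^bsub>kQ\<^esub> h) r = (\<Sum>m\<le>?N. (\<Sum>n\<le>?N - m. ?t (m + n) m))"
    by (simp add: mult_path_algebra path_algebra_mult_closed f g h len_suffix suffix_suffix
        prefix_suffix sum_distrib_right)
  also have "\<dots> = (\<Sum>(m, n)\<in>?C. ?t (m + n) m)" by (rule sum.Sigma) auto
  also have "\<dots> = (\<Sum>(n, m)\<in>?B. ?t n m)"
    by (rule sum.reindex_bij_witness[of _ "\<lambda>(n, m). (m, n - m)" "\<lambda>(m, n). (m + n, m)"]) auto
  also have "\<dots> = (\<Sum>n\<le>?N. (\<Sum>m\<le>n. ?t n m))" by (rule sum.Sigma[symmetric]) auto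
  also have "\<dots> = (\<Sum>n\<le>?N. f (path_suffix G n r) *
      (\<Sum>m\<le>n. g (path_suffix G m (path_prefix n r)) * h (path_prefix m (path_prefix n r))))"
    by (simp add: sum_distrib_left mult.assoc prefix_prefix)
  also have "\<dots> = (f \<otimes>\<^bsub>kQ\<^esub> (g \<otimes>\<^bsub>kQ\<^esub> h)) r"
    by (simp add: mult_path_algebra path_algebra_mult_closed f g h len_prefix)
  finally show "((f \<otimes>\<^bsub>kQ\<^esub> g) \<otimes>\<^bsub>kQ\<^esub> h) r = (f \<otimes>\<^bsub>kQ\<^esub> (g \<otimes>\<^bsub>kQ\<^esub> h)) r" .
qed

end

lemma path_algebra_simps:
  "(f \<oplus>\<^bsub>path_algebra Q\<^esub> g) p = f p + g p"
  "\<zero>\<^bsub>path_algebra Q\<^esub> p = 0"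
  "\<one>\<^bsub>path_algebra Q\<^esub> p = (if p \<in> paths Q \<and> len p = 0 then 1 else 0)"
  by (simp_all add: path_algebra_def)

context fin_digraph
begin

lemma path_algebra_one_closed: "(\<one>\<^bsub>kQ\<^esub> :: _ \<Rightarrow> 'k::field) \<in> carrier kQ"
proof -
  have "{p. (\<one>\<^bsub>kQ\<^esub> :: _ \<Rightarrow> 'k) p \<noteq> 0} \<subseteq> (\<lambda>v. (v, [])) ` verts G"
  proof
    fix p :: "('a, 'b) qpath" assume "p \<in> {p. (\<one>\<^bsub>kQ\<^esub> :: _ \<Rightarrow> 'k) p \<noteq> 0}"
    then have "p \<in> paths G" "snd p = []" by (auto simp: path_algebra_simps len_def split: if_splits)
    then show "p \<in> (\<lambda>v. (v, [])) ` verts G" by (cases p) auto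
  qed
  then show ?thesis
    by (auto simp: carrier_path_algebra path_algebra_simps intro: finite_subset split: if_splits)
qed

text \<open>The unit is the sum of the trivial paths, so the only surviving cut is the one that
  leaves a trivial path on its side: position \<open>len r\<close> for the left factor, position 0
  for the right factor.\<close>

lemma path_algebra_one_mult:
  fixes f :: "('a, 'b) qpath \<Rightarrow> 'k::field"
  assumes f: "f \<in> carrier kQ"
  shows "(\<lambda>p. c * \<one>\<^bsub>kQ\<^esub> p) \<otimes>\<^bsub>kQ\<^esub> f = (\<lambda>p. c * f p)"
    and "f \<otimes>\<^bsub>kQ\<^esub> (\<lambda>p. c * \<one>\<^bsub>kQ\<^esub> p) = (\<lambda>p. c * f p)"
proof -
  have out: "f p = 0" if "p \<notin> paths G" for p using f that by (auto simp: carrier_path_algebra)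
  have c1: "(\<lambda>p. c * \<one>\<^bsub>kQ\<^esub> p) \<in> carrier kQ"
    by (intro path_algebra_scale_closed path_algebra_one_closed)
  show "(\<lambda>p. c * \<one>\<^bsub>kQ\<^esub> p) \<otimes>\<^bsub>kQ\<^esub> f = (\<lambda>p. c * f p)"
  proof
    fix r
    have "((\<lambda>p. c * \<one>\<^bsub>kQ\<^esub> p) \<otimes>\<^bsub>kQ\<^esub> f) r =
        (\<Sum>n\<le>len r. if n = len r then c * f r else 0)"
      unfolding mult_path_algebra[OF c1 f]
    proof (rule sum.cong)
      fix n assume n: "n \<in> {..len r}"
      \<comment> \<open>The unit takes the value 1 at a trivial path only if its vertex belongs to
        the quiver. This holds when \<open>r\<close> is a path; otherwise \<open>f r\<close> is 0
        anyway.\<close>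
      have "path_suffix G (len r) r \<in> paths G" if "r \<in> paths G"
        using that paths_tgt[of "fst r" "snd r"] by (simp add: path_suffix_def path_prefix_def len_def)
      then show "c * \<one>\<^bsub>kQ\<^esub> (path_suffix G n r) * f (path_prefix n r) =
        (if n = len r then c * f r else 0)"
        using n out[of r] by (auto simp: path_algebra_simps len_suffix prefix_all)
    qed simp
    then show "((\<lambda>p. c * \<one>\<^bsub>kQ\<^esub> p) \<otimes>\<^bsub>kQ\<^esub> f) r = c * f r" by simp
  qed
  show "f \<otimes>\<^bsub>kQ\<^esub> (\<lambda>p. c * \<one>\<^bsub>kQ\<^esub> p) = (\<lambda>p. c * f p)"
  proof
    fix r
    have "(f \<otimes>\<^bsub>kQ\<^esub> (\<lambda>p. c * \<one>\<^bsub>kQ\<^esub> p)) r =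
        (\<Sum>n\<le>len r. if n = 0 then c * f r else 0)"
      unfolding mult_path_algebra[OF f c1]
    proof (rule sum.cong)
      fix n assume n: "n \<in> {..len r}"
      have "path_prefix 0 r \<in> paths G" if "r \<in> paths G"
        using that paths_fst[of "fst r" "snd r"] by (simp add: path_prefix_def)
      then show "f (path_suffix G n r) * (c * \<one>\<^bsub>kQ\<^esub> (path_prefix n r)) =
        (if n = 0 then c * f r else 0)"
        using n out[of r] by (auto simp: path_algebra_simps len_prefix)
    qed simp
    then show "(f \<otimes>\<^bsub>kQ\<^esub> (\<lambda>p. c * \<one>\<^bsub>kQ\<^esub> p)) r = c * f r" by simp
  qed
qed

lemma path_algebra_ring: "ring (kQ :: (_ \<Rightarrow> 'k::field) ring)"
proof (rule ringI)
  show "abelian_group (kQ :: (_ \<Rightarrow> 'k) ring)"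
  proof (rule abelian_groupI)
    fix x :: "_ \<Rightarrow> 'k" assume "x \<in> carrier kQ"
    then show "\<exists>y\<in>carrier kQ. y \<oplus>\<^bsub>kQ\<^esub> x = \<zero>\<^bsub>kQ\<^esub>"
      using path_algebra_scale_closed[of x "-1"]
      by (intro bexI[of _ "\<lambda>p. -1 * x p"]) (auto simp: path_algebra_simps fun_eq_iff)
  qed (auto simp: path_algebra_add_closed path_algebra_simps path_algebra_zero_closed
      fun_eq_iff)
  show "Group.monoid (kQ :: (_ \<Rightarrow> 'k) ring)"
    using path_algebra_one_mult[where c=1]
    by (auto intro!: monoidI simp: path_algebra_mult_closed path_algebra_one_closed path_algebra_mult_assoc)
qed (auto simp: mult_path_algebra path_algebra_add_closed path_algebra_simps fun_eq_iff
    sum.distrib distrib_left distrib_right)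

end

section \<open>The algebra with radical square zero\<close>

context fin_digraph
begin

section \<open>The square of the arrow ideal\<close>

lemma path_algebra_minus:
  fixes f :: "('a, 'b) qpath \<Rightarrow> 'k::field"
  assumes "f \<in> carrier kQ" "g \<in> carrier kQ"
  shows "(f \<ominus>\<^bsub>kQ\<^esub> g) p = f p - g p"
proof -
  interpret kQ: ring "kQ :: (_ \<Rightarrow> 'k) ring" by (rule path_algebra_ring)
  have "\<ominus>\<^bsub>kQ\<^esub> g = (\<lambda>p. -1 * g p)"
    using assms path_algebra_scale_closed[of g "-1"]
    by (intro kQ.minus_equality) (auto simp: path_algebra_simps fun_eq_iff)
  then show ?thesis by (simp add: kQ.minus_eq path_algebra_simps)
qed

text \<open>The filtration of the path algebra by path length: degree 0 is everything, degree 1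
  contains J, and degree 2 will turn out to be J^2.\<close>

definition long_elems :: "nat \<Rightarrow> (('a, 'b) qpath \<Rightarrow> 'k::field) set" where
  "long_elems n = {f \<in> carrier kQ. \<forall>p. len p < n \<longrightarrow> f p = 0}"

lemma long_elems_zero: "f \<in> long_elems n \<Longrightarrow> len p < n \<Longrightarrow> f p = 0"
  by (simp add: long_elems_def del: split_paired_All)

text \<open>A path shorter than m + n cannot be cut into a first piece of length at least n and a
  second one of length at least m, so every term of the convolution has a zero factor.\<close>

lemma long_elems_mult:
  fixes f g :: "('a, 'b) qpath \<Rightarrow> 'k::field"
  assumes "f \<in> long_elems m" "g \<in> long_elems n"
  shows "f \<otimes>\<^bsub>kQ\<^esub> g \<in> long_elems (m + n)"
proof -
  have "(f \<otimes>\<^bsub>kQ\<^esub> g) r = 0" if r: "len r < m + n" for r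
  proof -
    have "f (path_suffix G i r) * g (path_prefix i r) = 0" if "i \<in> {..len r}" for i
    proof (cases "i < n")
      case True
      then show ?thesis using that long_elems_zero[OF assms(2)] by (simp add: len_prefix)
    next
      case False
      then have "len r - i < m" using r that by auto
      then show ?thesis using long_elems_zero[OF assms(1)] by (simp add: len_suffix)
    qed
    then have "(\<Sum>i\<le>len r. f (path_suffix G i r) * g (path_prefix i r)) = 0"
      by (rule sum.neutral[OF ballI])
    then show ?thesis
      using assms by (simp add: mult_path_algebra long_elems_def)
  qed
  then show ?thesis using assms by (simp add: long_elems_def path_algebra_mult_closed)
qed

lemma long_elems_ideal: "ideal (long_elems n) (kQ :: (_ \<Rightarrow> 'k::field) ring)"
proof -
  interpret kQ: ring "kQ :: (_ \<Rightarrow> 'k) ring" by (rule path_algebra_ring)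
  \<comment> \<open>Absorption is the product estimate with one factor in degree 0, where
    \<open>long_elems\<close> is the whole carrier.\<close>
  have l: "x \<otimes>\<^bsub>kQ\<^esub> f \<in> long_elems n" and r: "f \<otimes>\<^bsub>kQ\<^esub> x \<in> long_elems n"
    if "f \<in> long_elems n" "x \<in> carrier kQ" for f x :: "_ \<Rightarrow> 'k"
    using long_elems_mult[of x 0 f n] long_elems_mult[of f n x 0] that
    by (simp_all add: long_elems_def)
  show ?thesis
  proof (rule idealI[OF path_algebra_ring])
    show "subgroup (long_elems n) (add_monoid (kQ :: (_ \<Rightarrow> 'k) ring))"
    proof
      fix x :: "_ \<Rightarrow> 'k" assume x: "x \<in> long_elems n"
      \<comment> \<open>Negation is multiplication by -1, hence covered by absorption.\<close>
      then have "\<ominus>\<^bsub>kQ\<^esub> x = (\<ominus>\<^bsub>kQ\<^esub> \<one>\<^bsub>kQ\<^esub>) \<otimes>\<^bsub>kQ\<^esub> x"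
        by (simp add: kQ.l_minus long_elems_def)
      then show "inv\<^bsub>add_monoid kQ\<^esub> x \<in> long_elems n"
        using l[OF x, of "\<ominus>\<^bsub>kQ\<^esub> \<one>\<^bsub>kQ\<^esub>"] by (metis a_inv_def kQ.a_inv_closed kQ.one_closed)
    qed (auto simp: long_elems_def path_algebra_simps path_algebra_zero_closed path_algebra_add_closed)
  qed (use l r in auto)
qed

lemma arrow_path_in_paths: "\<alpha> \<in> arcs G \<Longrightarrow> arrow_path G \<alpha> \<in> paths G"
  by (simp add: arrow_path_def)

lemma arrow_generators:
  "(\<lambda>\<alpha>. path_elem (arrow_path G \<alpha>)) ` arcs G \<subseteq> carrier (kQ :: (_ \<Rightarrow> 'k::field) ring)"
  by (auto simp: path_elem_monom intro: path_monom_closed arrow_path_in_paths)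

lemma arrow_ideal_ideal: "ideal (arrow_ideal G) (kQ :: (_ \<Rightarrow> 'k::field) ring)"
  unfolding arrow_ideal_def by (intro ring.genideal_ideal path_algebra_ring arrow_generators)

lemma arrow_ideal_sq_ideal: "ideal (arrow_ideal_sq G) (kQ :: (_ \<Rightarrow> 'k::field) ring)"
  unfolding arrow_ideal_sq_def
  by (intro ring.ideal_prod_is_ideal path_algebra_ring arrow_ideal_ideal)

lemma arrow_ideal_subset: "arrow_ideal G \<subseteq> (long_elems 1 :: (_ \<Rightarrow> 'k::field) set)"
  unfolding arrow_ideal_def
proof (rule ring.genideal_minimal[OF path_algebra_ring long_elems_ideal])
  show "(\<lambda>\<alpha>. path_elem (arrow_path G \<alpha>)) ` arcs G \<subseteq> (long_elems 1 :: (_ \<Rightarrow> 'k) set)"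
    using arrow_generators[where 'k='k]
    by (auto simp: long_elems_def path_elem_def arrow_path_def len_def)
qed

lemma arrow_ideal_sq_subset: "arrow_ideal_sq G \<subseteq> (long_elems 2 :: (_ \<Rightarrow> 'k::field) set)"
proof
  fix f :: "_ \<Rightarrow> 'k" assume "f \<in> arrow_ideal_sq G"
  then show "f \<in> long_elems 2"
    unfolding arrow_ideal_sq_def
  proof (induction rule: ideal_prod.induct)
    case (prod i j)
    then show ?case
      using long_elems_mult[of i 1 j 1] arrow_ideal_subset by (auto simp: numeral_2_eq_2)
  next
    case (sum s t)
    then show ?case
      by (simp add: additive_subgroup.a_closed ideal.axioms(1) long_elems_ideal)
  qed
qed

text \<open>Splits off the arrow traversed last, which is the left factor, and leaves the scalar
  with the rest. This puts the path into J, and into J^2 when the rest still has positive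
  length.\<close>

lemma path_monom_snoc:
  assumes "(v, as @ [a]) \<in> paths G"
  shows "path_monom (c::'k::field) (v, as @ [a]) =
    path_elem (arrow_path G a) \<otimes>\<^bsub>kQ\<^esub> path_monom c (v, as)"
  unfolding path_elem_monom using assms
  by (subst path_monom_mult) (auto simp: arrow_path_def src_def path_comp_def)

lemma path_elem_arrow_in_ideal: "\<alpha> \<in> arcs G \<Longrightarrow> path_elem (arrow_path G \<alpha>) \<in> arrow_ideal G"
  unfolding arrow_ideal_def
  using ring.genideal_self[OF path_algebra_ring arrow_generators] by auto

lemma path_monom_in_arrow_ideal:
  assumes "p \<in> paths G" "len p \<ge> 1"
  shows "path_monom (c::'k::field) p \<in> arrow_ideal G"
proof -
  obtain v as a where p: "p = (v, as @ [a])"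
    using assms(2) by (cases p; cases "snd p" rule: rev_cases) (auto simp: len_def)
  show ?thesis
    using assms(1) unfolding p
    by (auto simp: path_monom_snoc
        intro!: ideal.I_r_closed[OF arrow_ideal_ideal] path_elem_arrow_in_ideal path_monom_closed)
qed

lemma path_monom_in_arrow_ideal_sq:
  assumes "p \<in> paths G" "len p \<ge> 2"
  shows "path_monom (c::'k::field) p \<in> arrow_ideal_sq G"
proof -
  obtain v as a where p: "p = (v, as @ [a])"
    using assms(2) by (cases p; cases "snd p" rule: rev_cases) (auto simp: len_def)
  then have "len (v, as) \<ge> 1" using assms(2) by (simp add: len_def)
  then show ?thesis
    using assms(1) unfolding p arrow_ideal_sq_def
    by (auto simp: path_monom_snoc
        intro!: ideal_prod.prod path_elem_arrow_in_ideal path_monom_in_arrow_ideal)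
qed

text \<open>For the inclusion not yet known, the finite support is removed one path at a time; each
  removed monomial has length at least 2 and so lies in J^2. A generated ideal thereby becomes a
  condition on coefficients.\<close>

lemma arrow_ideal_sq_eq: "arrow_ideal_sq G = (long_elems 2 :: (_ \<Rightarrow> 'k::field) set)"
proof (rule equalityI[OF arrow_ideal_sq_subset], rule subsetI)
  interpret J2: ideal "arrow_ideal_sq G" "kQ :: (_ \<Rightarrow> 'k) ring" by (rule arrow_ideal_sq_ideal)
  fix f :: "_ \<Rightarrow> 'k" assume f: "f \<in> long_elems 2"
  have "finite {p. f p \<noteq> 0}" using f by (simp add: long_elems_def carrier_path_algebra)
  then show "f \<in> arrow_ideal_sq G"
    using f
  proof (induction "{p. f p \<noteq> 0}" arbitrary: f rule: finite_induct)
    case empty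
    then have "f = \<zero>\<^bsub>kQ\<^esub>" by (simp add: fun_eq_iff path_algebra_simps)
    then show ?case using J2.zero_closed by simp
  next
    case (insert p S)
    let ?g = "f(p := 0)"
    have S: "S = {q. ?g q \<noteq> 0}" using insert.hyps(2,4) by auto
    then have g: "?g \<in> long_elems 2"
      using insert.prems insert.hyps(1,4) by (auto simp: long_elems_def carrier_path_algebra)
    have "f p \<noteq> 0" using insert.hyps(4) by blast
    then have p: "p \<in> paths G" "len p \<ge> 2"
      using insert.prems long_elems_zero[OF insert.prems, of p]
      by (auto simp: long_elems_def carrier_path_algebra not_less[symmetric])
    have eq: "?g \<oplus>\<^bsub>kQ\<^esub> path_monom (f p) p = f"
      by (auto simp: fun_eq_iff path_algebra_simps path_monom_def)
    show ?case
      using additive_subgroup.a_closed[OF J2.additive_subgroup_axioms insert.hyps(3)[OF S g] path_monom_in_arrow_ideal_sq[OF p, of "f p"]]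
      unfolding eq .
  qed
qed

section \<open>The quotient algebra in coordinates\<close>

lemma rsz_algebra_ring: "ring (rsz_algebra G :: ('a, 'b, 'k::field) rsz ring)"
  unfolding rsz_algebra_def by (intro ideal.quotient_is_ring arrow_ideal_sq_ideal)

lemma carrier_rsz_algebra: "carrier (rsz_algebra G :: ('a, 'b, 'k::field) rsz ring) = rsz_class G ` carrier kQ"
  by (auto simp: rsz_algebra_def FactRing_def A_RCOSETS_def RCOSETS_def a_r_coset_def rsz_class_def)

lemma rsz_class_hom: "rsz_class G \<in> ring_hom kQ (rsz_algebra G :: ('a, 'b, 'k::field) rsz ring)"
  using ideal.rcos_ring_hom[OF arrow_ideal_sq_ideal[where 'k='k]]
  by (simp add: rsz_class_def[abs_def] rsz_algebra_def)

lemma path_short_cases: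
  assumes "p \<in> paths G" "len p < 2"
  obtains i where "i \<in> verts G" "p = (i, [])" | \<alpha> where "\<alpha> \<in> arcs G" "p = (tail G \<alpha>, [\<alpha>])"
proof -
  obtain v as where p: "p = (v, as)" by (cases p)
  show thesis
  proof (cases as)
    case Nil
    then show ?thesis using assms p that(1) by simp
  next
    case (Cons a bs)
    then show ?thesis using assms p that(2)[of a] by (simp add: len_def)
  qed
qed

text \<open>The difference must lie in degree 2 of the length filtration, so only paths of length 0
  and 1 count; at pairs that are not paths both functions vanish.\<close>

lemma rsz_class_eq_iff:
  fixes f g :: "('a, 'b) qpath \<Rightarrow> 'k::field"
  assumes f: "f \<in> carrier kQ" and g: "g \<in> carrier kQ"
  shows "rsz_class G f = rsz_class G g \<longleftrightarrow>
    (\<forall>i\<in>verts G. f (i, []) = g (i, [])) \<and> (\<forall>\<alpha>\<in>arcs G. f (tail G \<alpha>, [\<alpha>]) = g (tail G \<alpha>, [\<alpha>]))"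
proof -
  interpret kQ: ring "kQ :: (_ \<Rightarrow> 'k) ring" by (rule path_algebra_ring)
  have "rsz_class G f = rsz_class G g \<longleftrightarrow> f \<ominus>\<^bsub>kQ\<^esub> g \<in> arrow_ideal_sq G"
    unfolding rsz_class_def
    using kQ.quotient_eq_iff_same_a_r_cos[OF arrow_ideal_sq_ideal f g] by simp
  also have "\<dots> \<longleftrightarrow> (\<forall>p. len p < 2 \<longrightarrow> f p = g p)"
    using f g by (simp add: arrow_ideal_sq_eq long_elems_def path_algebra_minus)
  also have "\<dots> \<longleftrightarrow> (\<forall>i\<in>verts G. f (i, []) = g (i, [])) \<and>
      (\<forall>\<alpha>\<in>arcs G. f (tail G \<alpha>, [\<alpha>]) = g (tail G \<alpha>, [\<alpha>]))" (is "_ \<longleftrightarrow> ?R")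
  proof (intro iffI allI impI)
    fix p :: "('a, 'b) qpath" assume R: ?R and p: "len p < 2"
    show "f p = g p"
    proof (cases "p \<in> paths G")
      case True
      then show ?thesis using R p by (elim path_short_cases) auto
    next
      case False
      then have "f p = 0" "g p = 0" using f g by (auto simp: carrier_path_algebra)
      then show ?thesis by simp
    qed
  qed (auto simp: len_def)
  finally show ?thesis .
qed

text \<open>Elements of A are cosets, so the coefficient is read off a chosen representative;
  \<open>coeff_class\<close> shows that the choice does not matter at vertices and arrows of the
  quiver.\<close>

definition vcoeff :: "('a, 'b, 'k::field) rsz \<Rightarrow> 'a \<Rightarrow> 'k" where
  "vcoeff X i = (SOME f. f \<in> carrier kQ \<and> X = rsz_class G f) (i, [])"

definition acoeff :: "('a, 'b, 'k::field) rsz \<Rightarrow> 'b \<Rightarrow> 'k" where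
  "acoeff X \<alpha> = (SOME f. f \<in> carrier kQ \<and> X = rsz_class G f) (tail G \<alpha>, [\<alpha>])"

lemma coeff_class:
  fixes f :: "('a, 'b) qpath \<Rightarrow> 'k::field"
  assumes f: "f \<in> carrier kQ"
  shows "i \<in> verts G \<Longrightarrow> vcoeff (rsz_class G f) i = f (i, [])"
    and "\<alpha> \<in> arcs G \<Longrightarrow> acoeff (rsz_class G f) \<alpha> = f (tail G \<alpha>, [\<alpha>])"
proof -
  let ?g = "SOME g. g \<in> carrier kQ \<and> rsz_class G f = rsz_class G g"
  have "?g \<in> carrier kQ \<and> rsz_class G f = rsz_class G ?g"
    by (rule someI[of _ f]) (simp add: f)
  then have g: "?g \<in> carrier kQ" and eq: "rsz_class G f = rsz_class G ?g" by blast+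
  show "i \<in> verts G \<Longrightarrow> vcoeff (rsz_class G f) i = f (i, [])"
    and "\<alpha> \<in> arcs G \<Longrightarrow> acoeff (rsz_class G f) \<alpha> = f (tail G \<alpha>, [\<alpha>])"
    using eq unfolding rsz_class_eq_iff[OF f g] by (simp_all add: vcoeff_def acoeff_def)
qed

abbreviation A :: "('a, 'b, 'k::field) rsz ring" where
  "A \<equiv> rsz_algebra G"

lemma rsz_eqI:
  fixes X Y :: "('a, 'b, 'k::field) rsz"
  assumes "X \<in> carrier A" "Y \<in> carrier A"
    and "\<And>i. i \<in> verts G \<Longrightarrow> vcoeff X i = vcoeff Y i"
    and "\<And>\<alpha>. \<alpha> \<in> arcs G \<Longrightarrow> acoeff X \<alpha> = acoeff Y \<alpha>"
  shows "X = Y"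
proof -
  obtain f g where fg: "f \<in> carrier kQ" "g \<in> carrier kQ" "X = rsz_class G f" "Y = rsz_class G g"
    using assms(1,2) by (auto simp: carrier_rsz_algebra)
  then show ?thesis using assms(3,4) by (simp add: coeff_class rsz_class_eq_iff)
qed

lemma coeff_add:
  fixes X Y :: "('a, 'b, 'k::field) rsz"
  assumes "X \<in> carrier A" "Y \<in> carrier A"
  shows "i \<in> verts G \<Longrightarrow> vcoeff (X \<oplus>\<^bsub>A\<^esub> Y) i = vcoeff X i + vcoeff Y i"
    and "\<alpha> \<in> arcs G \<Longrightarrow> acoeff (X \<oplus>\<^bsub>A\<^esub> Y) \<alpha> = acoeff X \<alpha> + acoeff Y \<alpha>"
proof -
  obtain f g where fg: "f \<in> carrier kQ" "g \<in> carrier kQ" "X = rsz_class G f" "Y = rsz_class G g"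
    using assms by (auto simp: carrier_rsz_algebra)
  then have "X \<oplus>\<^bsub>A\<^esub> Y = rsz_class G (f \<oplus>\<^bsub>kQ\<^esub> g)"
    by (simp add: ring_hom_add[OF rsz_class_hom])
  then show "i \<in> verts G \<Longrightarrow> vcoeff (X \<oplus>\<^bsub>A\<^esub> Y) i = vcoeff X i + vcoeff Y i"
    and "\<alpha> \<in> arcs G \<Longrightarrow> acoeff (X \<oplus>\<^bsub>A\<^esub> Y) \<alpha> = acoeff X \<alpha> + acoeff Y \<alpha>"
    using fg by (simp_all add: coeff_class path_algebra_add_closed path_algebra_simps)
qed

text \<open>A trivial path has one cut, and an arrow has two, before and after itself; these account
  for the one and the two terms.\<close>

lemma coeff_mult:
  fixes X Y :: "('a, 'b, 'k::field) rsz"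
  assumes "X \<in> carrier A" "Y \<in> carrier A"
  shows "i \<in> verts G \<Longrightarrow> vcoeff (X \<otimes>\<^bsub>A\<^esub> Y) i = vcoeff X i * vcoeff Y i"
    and "\<alpha> \<in> arcs G \<Longrightarrow> acoeff (X \<otimes>\<^bsub>A\<^esub> Y) \<alpha> =
      acoeff X \<alpha> * vcoeff Y (tail G \<alpha>) + vcoeff X (head G \<alpha>) * acoeff Y \<alpha>"
proof -
  obtain f g where fg: "f \<in> carrier kQ" "g \<in> carrier kQ" "X = rsz_class G f" "Y = rsz_class G g"
    using assms by (auto simp: carrier_rsz_algebra)
  have eq: "X \<otimes>\<^bsub>A\<^esub> Y = rsz_class G (f \<otimes>\<^bsub>kQ\<^esub> g)"
    using fg by (simp add: ring_hom_mult[OF rsz_class_hom])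
  show "i \<in> verts G \<Longrightarrow> vcoeff (X \<otimes>\<^bsub>A\<^esub> Y) i = vcoeff X i * vcoeff Y i"
    unfolding eq using fg
    by (simp add: coeff_class path_algebra_mult_closed mult_path_algebra len_def path_prefix_def
        path_suffix_def tgt_conv)
  show "acoeff (X \<otimes>\<^bsub>A\<^esub> Y) \<alpha> =
      acoeff X \<alpha> * vcoeff Y (tail G \<alpha>) + vcoeff X (head G \<alpha>) * acoeff Y \<alpha>" if "\<alpha> \<in> arcs G"
    unfolding eq using fg that
    by (simp add: coeff_class path_algebra_mult_closed mult_path_algebra len_def path_prefix_def
        path_suffix_def tgt_conv)
qed

lemma rsz_exists:
  fixes u :: "'a \<Rightarrow> 'k::field" and b :: "'b \<Rightarrow> 'k"
  obtains X where "X \<in> carrier A" "\<And>i. i \<in> verts G \<Longrightarrow> vcoeff X i = u i"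
    "\<And>\<alpha>. \<alpha> \<in> arcs G \<Longrightarrow> acoeff X \<alpha> = b \<alpha>"
proof -
  \<comment> \<open>The representative without long paths; \<open>hd\<close> merely names the only
    arrow of a list of length 1.\<close>
  let ?f = "\<lambda>p. if p \<in> paths G \<and> len p < 2 then
      (if snd p = [] then u (fst p) else b (hd (snd p))) else 0"
  have "{p. ?f p \<noteq> 0} \<subseteq> (\<lambda>i. (i, [])) ` verts G \<union> (\<lambda>\<alpha>. (tail G \<alpha>, [\<alpha>])) ` arcs G"
  proof
    fix p assume "p \<in> {p. ?f p \<noteq> 0}"
    then have "p \<in> paths G" "len p < 2" by (auto split: if_splits)
    then show "p \<in> (\<lambda>i. (i, [])) ` verts G \<union> (\<lambda>\<alpha>. (tail G \<alpha>, [\<alpha>])) ` arcs G"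
      by (cases rule: path_short_cases) auto
  qed
  then have "finite {p. ?f p \<noteq> 0}" by (rule finite_subset) simp
  then have f: "?f \<in> carrier kQ"
    unfolding carrier_path_algebra by (auto split: if_splits)
  show thesis
  proof (rule that[of "rsz_class G ?f"])
    show "rsz_class G ?f \<in> carrier A" unfolding carrier_rsz_algebra using f by (rule imageI)
  qed (simp_all add: coeff_class[OF f], simp_all add: len_def)
qed

lemma rsz_vertex_closed: "i \<in> verts G \<Longrightarrow> rsz_vertex G i \<in> carrier A"
  by (simp add: rsz_vertex_def carrier_rsz_algebra path_elem_monom path_monom_closed triv_path_def)

lemma rsz_arrow_closed: "\<alpha> \<in> arcs G \<Longrightarrow> rsz_arrow G \<alpha> \<in> carrier A"
  by (simp add: rsz_arrow_def carrier_rsz_algebra path_elem_monom path_monom_closed arrow_path_def)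

lemma rsz_scalar_closed: "rsz_scalar G c \<in> carrier A"
  by (simp add: rsz_scalar_def carrier_rsz_algebra path_algebra_scale_closed path_algebra_one_closed)

lemma coeff_rsz_vertex:
  assumes "j \<in> verts G"
  shows "i \<in> verts G \<Longrightarrow> vcoeff (rsz_vertex G j :: ('a, 'b, 'k::field) rsz) i = (if i = j then 1 else 0)"
    and "\<alpha> \<in> arcs G \<Longrightarrow> acoeff (rsz_vertex G j :: ('a, 'b, 'k::field) rsz) \<alpha> = 0"
  using assms
  by (simp_all add: rsz_vertex_def coeff_class path_elem_monom path_monom_closed triv_path_def)
    (simp_all add: path_monom_def)

lemma coeff_rsz_arrow:
  assumes "\<beta> \<in> arcs G"
  shows "i \<in> verts G \<Longrightarrow> vcoeff (rsz_arrow G \<beta> :: ('a, 'b, 'k::field) rsz) i = 0"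
    and "\<alpha> \<in> arcs G \<Longrightarrow> acoeff (rsz_arrow G \<beta> :: ('a, 'b, 'k::field) rsz) \<alpha> = (if \<alpha> = \<beta> then 1 else 0)"
  using assms
  by (simp_all add: rsz_arrow_def coeff_class path_elem_monom path_monom_closed arrow_path_def)
    (auto simp add: path_monom_def)

lemma coeff_rsz_scalar:
  shows "i \<in> verts G \<Longrightarrow> vcoeff (rsz_scalar G c :: ('a, 'b, 'k::field) rsz) i = c"
    and "\<alpha> \<in> arcs G \<Longrightarrow> acoeff (rsz_scalar G c :: ('a, 'b, 'k::field) rsz) \<alpha> = 0"
  by (simp_all add: rsz_scalar_def coeff_class path_algebra_scale_closed path_algebra_one_closed)
    (simp_all add: path_algebra_simps len_def)

end

section \<open>The injective modules\<close>

context fin_digraph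
begin

text \<open>Left multiplication by e_i keeps the coefficients at i and at the arrows ending at i and
  kills the others, so e_i A consists of the elements that it fixes.\<close>

lemma right_proj_eq:
  assumes i: "i \<in> verts G"
  shows "(right_proj G i :: ('a, 'b, 'k::field) rsz set) =
    {X \<in> carrier A. (\<forall>j\<in>verts G. j \<noteq> i \<longrightarrow> vcoeff X j = 0) \<and>
      (\<forall>\<alpha>\<in>arcs G. head G \<alpha> \<noteq> i \<longrightarrow> acoeff X \<alpha> = 0)}" (is "_ = ?R")
proof -
  interpret A: ring "A :: ('a, 'b, 'k) rsz ring" by (rule rsz_algebra_ring)
  have e: "rsz_vertex G i \<in> carrier (A :: ('a, 'b, 'k) rsz ring)" by (rule rsz_vertex_closed[OF i])
  show ?thesis
  proof (intro equalityI subsetI)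
    fix X :: "('a, 'b, 'k) rsz" assume "X \<in> right_proj G i"
    then show "X \<in> ?R"
      using e i by (auto simp: right_proj_def coeff_mult coeff_rsz_vertex)
  next
    fix X :: "('a, 'b, 'k) rsz" assume X: "X \<in> ?R"
    then have "rsz_vertex G i \<otimes>\<^bsub>A\<^esub> X = X"
      using e i by (intro rsz_eqI) (auto simp: coeff_mult coeff_rsz_vertex)
    then show "X \<in> right_proj G i" using X unfolding right_proj_def by (metis (lifting) image_eqI mem_Collect_eq)
  qed
qed

lemma right_proj_carrier:
  "i \<in> verts G \<Longrightarrow> X \<in> right_proj G i \<Longrightarrow> X \<in> carrier (A :: ('a, 'b, 'k::field) rsz ring)"
  by (simp add: right_proj_eq)

lemma right_proj_coeff:
  assumes "i \<in> verts G" "X \<in> (right_proj G i :: ('a, 'b, 'k::field) rsz set)"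
  shows "j \<in> verts G \<Longrightarrow> j \<noteq> i \<Longrightarrow> vcoeff X j = 0"
    and "\<alpha> \<in> arcs G \<Longrightarrow> head G \<alpha> \<noteq> i \<Longrightarrow> acoeff X \<alpha> = 0"
  using assms by (auto simp: right_proj_eq)

lemma right_proj_closed:
  assumes i: "i \<in> verts G"
  shows right_proj_add: "X \<in> right_proj G i \<Longrightarrow> Y \<in> right_proj G i \<Longrightarrow>
      X \<oplus>\<^bsub>A\<^esub> Y \<in> (right_proj G i :: ('a, 'b, 'k::field) rsz set)"
    and right_proj_mult: "X \<in> right_proj G i \<Longrightarrow> Z \<in> carrier A \<Longrightarrow>
      X \<otimes>\<^bsub>A\<^esub> Z \<in> (right_proj G i :: ('a, 'b, 'k::field) rsz set)"
    and right_proj_scale: "X \<in> right_proj G i \<Longrightarrow>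
      rsz_scalar G c \<otimes>\<^bsub>A\<^esub> X \<in> (right_proj G i :: ('a, 'b, 'k::field) rsz set)"
    and right_proj_vertex: "rsz_vertex G i \<in> (right_proj G i :: ('a, 'b, 'k::field) rsz set)"
proof -
  interpret A: ring "A :: ('a, 'b, 'k) rsz ring" by (rule rsz_algebra_ring)
  note [simp] = right_proj_eq[OF i] coeff_add coeff_mult coeff_rsz_scalar coeff_rsz_vertex
    rsz_scalar_closed rsz_vertex_closed i
  show "X \<in> right_proj G i \<Longrightarrow> Y \<in> right_proj G i \<Longrightarrow>
      X \<oplus>\<^bsub>A\<^esub> Y \<in> (right_proj G i :: ('a, 'b, 'k::field) rsz set)" by simp
  show "X \<in> right_proj G i \<Longrightarrow> Z \<in> carrier A \<Longrightarrow>
      X \<otimes>\<^bsub>A\<^esub> Z \<in> (right_proj G i :: ('a, 'b, 'k::field) rsz set)" by simp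
  show "X \<in> right_proj G i \<Longrightarrow>
      rsz_scalar G c \<otimes>\<^bsub>A\<^esub> X \<in> (right_proj G i :: ('a, 'b, 'k::field) rsz set)" by simp
  show "rsz_vertex G i \<in> (right_proj G i :: ('a, 'b, 'k::field) rsz set)" by simp
qed

lemma right_proj_arrow:
  "\<alpha> \<in> arcs G \<Longrightarrow> rsz_arrow G \<alpha> \<in> (right_proj G (head G \<alpha>) :: ('a, 'b, 'k::field) rsz set)"
  by (auto simp: right_proj_eq coeff_rsz_arrow rsz_arrow_closed)

section \<open>The dual modules and their dual bases\<close>

lemma inj_module_simps:
  "\<phi> \<oplus>\<^bsub>inj_module G i\<^esub> \<psi> = (\<lambda>x\<in>right_proj G i. \<phi> x + \<psi> x)"
  "\<zero>\<^bsub>inj_module G i\<^esub> = (\<lambda>x\<in>right_proj G i. 0)"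
  "a \<odot>\<^bsub>inj_module G i\<^esub> \<phi> = (\<lambda>x\<in>right_proj G i. \<phi> (x \<otimes>\<^bsub>A\<^esub> a))"
  by (simp_all add: inj_module_def)

lemma carrier_inj_module:
  "\<phi> \<in> carrier (inj_module G i) \<longleftrightarrow> \<phi> \<in> extensional (right_proj G i) \<and>
     (\<forall>x\<in>right_proj G i. \<forall>y\<in>right_proj G i. \<phi> (x \<oplus>\<^bsub>A\<^esub> y) = \<phi> x + \<phi> y) \<and>
     (\<forall>c. \<forall>x\<in>right_proj G i. \<phi> (rsz_scalar G c \<otimes>\<^bsub>A\<^esub> x) = c * \<phi> x)"
  by (simp add: inj_module_def)

lemma inj_module_left_module:
  assumes i: "i \<in> verts G"
  shows "left_module A (inj_module G i :: (('a, 'b, 'k::field) rsz, _) module)"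
proof -
  interpret A: ring "A :: ('a, 'b, 'k) rsz ring" by (rule rsz_algebra_ring)
  note [simp] = right_proj_closed[OF i] right_proj_carrier[OF i] rsz_scalar_closed
  show ?thesis
  proof (intro left_module.intro left_module_axioms.intro rsz_algebra_ring)
    show "abelian_group (inj_module G i :: (('a, 'b, 'k) rsz, _) module)"
    proof (rule abelian_groupI)
      fix \<phi> :: "('a, 'b, 'k) rsz \<Rightarrow> 'k" assume \<phi>: "\<phi> \<in> carrier (inj_module G i)"
      show "\<zero>\<^bsub>inj_module G i\<^esub> \<oplus>\<^bsub>inj_module G i\<^esub> \<phi> = \<phi>"
        using \<phi> by (auto simp: carrier_inj_module inj_module_simps extensional_def restrict_def fun_eq_iff)
      show "\<exists>\<psi>\<in>carrier (inj_module G i). \<psi> \<oplus>\<^bsub>inj_module G i\<^esub> \<phi> = \<zero>\<^bsub>inj_module G i\<^esub>"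
        using \<phi>
        by (intro bexI[of _ "\<lambda>x\<in>right_proj G i. - \<phi> x"])
          (auto simp: carrier_inj_module inj_module_simps fun_eq_iff)
    qed (auto simp: carrier_inj_module inj_module_simps algebra_simps fun_eq_iff)
  qed (auto simp: carrier_inj_module inj_module_simps algebra_simps fun_eq_iff A.m_assoc A.l_distr
      A.r_distr restrict_def extensional_def)
qed

text \<open>A functional is only known to be additive and homogeneous, so the expansion comes from
  induction on a finite set of arrows outside which the arrow coefficients of \<open>X\<close>
  vanish.\<close>

lemma inj_module_expand:
  fixes X :: "('a, 'b, 'k::field) rsz"
  assumes i: "i \<in> verts G" and \<phi>: "\<phi> \<in> carrier (inj_module G i)" and X: "X \<in> right_proj G i"
  shows "\<phi> X = vcoeff X i * \<phi> (rsz_vertex G i) +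
    (\<Sum>\<alpha> | \<alpha> \<in> arcs G \<and> head G \<alpha> = i. acoeff X \<alpha> * \<phi> (rsz_arrow G \<alpha>))"
proof -
  interpret A: ring "A :: ('a, 'b, 'k) rsz ring" by (rule rsz_algebra_ring)
  have *: "\<phi> X = vcoeff X i * \<phi> (rsz_vertex G i) + (\<Sum>\<alpha>\<in>S. acoeff X \<alpha> * \<phi> (rsz_arrow G \<alpha>))"
    if "finite S" "S \<subseteq> {\<alpha>. \<alpha> \<in> arcs G \<and> head G \<alpha> = i}" "X \<in> right_proj G i"
      "\<forall>\<alpha>\<in>arcs G - S. acoeff X \<alpha> = 0" for S and X :: "('a, 'b, 'k) rsz"
    using that
  proof (induction S arbitrary: X rule: finite_induct)
    case empty
    then have "X = rsz_scalar G (vcoeff X i) \<otimes>\<^bsub>A\<^esub> rsz_vertex G i"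
      using i by (intro rsz_eqI)
        (auto simp: right_proj_eq coeff_mult coeff_rsz_scalar coeff_rsz_vertex rsz_scalar_closed rsz_vertex_closed)
    then have "\<phi> X = vcoeff X i * \<phi> (rsz_vertex G i)"
      using \<phi> right_proj_vertex[OF i, where 'k='k] unfolding carrier_inj_module by metis
    then show ?case by simp
  next
    case (insert \<beta> S)
    let ?c = "acoeff X \<beta>"
    have \<beta>: "\<beta> \<in> arcs G" "head G \<beta> = i" using insert.prems by auto
    \<comment> \<open>\<open>Y\<close> is \<open>X\<close> with its coefficient at \<beta> erased,
      so that the induction hypothesis for \<open>S\<close> applies to it.\<close>
    obtain Y where Y: "Y \<in> carrier A" "\<And>j. j \<in> verts G \<Longrightarrow> vcoeff Y j = vcoeff X j"
      "\<And>\<alpha>. \<alpha> \<in> arcs G \<Longrightarrow> acoeff Y \<alpha> = (if \<alpha> = \<beta> then 0 else acoeff X \<alpha>)"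
      using rsz_exists[of "vcoeff X" "\<lambda>\<alpha>. if \<alpha> = \<beta> then 0 else acoeff X \<alpha>"] by blast
    have Yp: "Y \<in> right_proj G i" using Y insert.prems(2) by (auto simp: right_proj_eq[OF i])
    have bp: "rsz_arrow G \<beta> \<in> (right_proj G i :: ('a, 'b, 'k) rsz set)"
      using right_proj_arrow[of \<beta>, where 'k='k] \<beta> by simp
    have "X = Y \<oplus>\<^bsub>A\<^esub> rsz_scalar G ?c \<otimes>\<^bsub>A\<^esub> rsz_arrow G \<beta>"
      using \<beta> Y(1) right_proj_carrier[OF i insert.prems(2)] i
      by (intro rsz_eqI) (auto simp: coeff_add coeff_mult coeff_rsz_scalar coeff_rsz_arrow
          rsz_scalar_closed rsz_arrow_closed Y(2,3))
    then have "\<phi> X = \<phi> Y + ?c * \<phi> (rsz_arrow G \<beta>)"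
      using \<phi> Yp bp right_proj_scale[OF i bp, of ?c] unfolding carrier_inj_module by metis
    also have "\<phi> Y = vcoeff Y i * \<phi> (rsz_vertex G i) + (\<Sum>\<alpha>\<in>S. acoeff Y \<alpha> * \<phi> (rsz_arrow G \<alpha>))"
      using insert.prems Yp Y(3) by (intro insert.IH) auto
    also have "(\<Sum>\<alpha>\<in>S. acoeff Y \<alpha> * \<phi> (rsz_arrow G \<alpha>)) = (\<Sum>\<alpha>\<in>S. acoeff X \<alpha> * \<phi> (rsz_arrow G \<alpha>))"
    proof (rule sum.cong)
      fix \<alpha> assume "\<alpha> \<in> S"
      then have "\<alpha> \<in> arcs G" "\<alpha> \<noteq> \<beta>" using insert.prems(1) insert.hyps(2) by auto
      then show "acoeff Y \<alpha> * \<phi> (rsz_arrow G \<alpha>) = acoeff X \<alpha> * \<phi> (rsz_arrow G \<alpha>)" by (simp add: Y(3))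
    qed simp
    finally show ?case using insert.hyps Y(2)[OF i] by (simp add: add.commute add.left_commute)
  qed
  show ?thesis
    by (rule *) (use X right_proj_coeff[OF i X] in auto)
qed

lemma inj_module_eqI:
  assumes i: "i \<in> verts G"
    and "\<phi> \<in> carrier (inj_module G i)" "\<psi> \<in> carrier (inj_module G i)"
    and "\<phi> (rsz_vertex G i) = (\<psi> (rsz_vertex G i) :: 'k::field)"
    and "\<And>\<alpha>. \<alpha> \<in> arcs G \<Longrightarrow> head G \<alpha> = i \<Longrightarrow> \<phi> (rsz_arrow G \<alpha>) = \<psi> (rsz_arrow G \<alpha>)"
  shows "\<phi> = \<psi>"
proof (rule extensionalityI[of _ "right_proj G i"])
  fix X assume X: "X \<in> (right_proj G i :: ('a, 'b, 'k) rsz set)"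
  show "\<phi> X = \<psi> X"
    unfolding inj_module_expand[OF i assms(2) X] inj_module_expand[OF i assms(3) X]
    using assms(4,5) by (auto intro!: sum.cong)
qed (use assms(2,3) in \<open>auto simp: carrier_inj_module\<close>)

text \<open>The combination of dual basis elements with coefficient c at e_i and b \<alpha> at each
  arrow \<alpha>. It is given by a formula because the dual basis itself is only described by its
  values and still needs an existence proof.\<close>

definition dual_comb :: "'a \<Rightarrow> 'k::field \<Rightarrow> ('b \<Rightarrow> 'k) \<Rightarrow> ('a, 'b, 'k) rsz \<Rightarrow> 'k" where
  "dual_comb i c b = (\<lambda>X\<in>right_proj G i. c * vcoeff X i +
     (\<Sum>\<alpha> | \<alpha> \<in> arcs G \<and> head G \<alpha> = i. b \<alpha> * acoeff X \<alpha>))"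

lemma dual_comb_closed:
  assumes i: "i \<in> verts G"
  shows "dual_comb i (c::'k::field) b \<in> carrier (inj_module G i)"
  unfolding carrier_inj_module
  using i
  by (auto simp: dual_comb_def right_proj_closed right_proj_carrier[OF i] coeff_add coeff_mult
      coeff_rsz_scalar rsz_scalar_closed algebra_simps sum.distrib sum_distrib_left)

lemma dual_comb_basis:
  shows "i \<in> verts G \<Longrightarrow> dual_comb i (c::'k::field) b (rsz_vertex G i) = c"
    and "\<alpha> \<in> arcs G \<Longrightarrow> dual_comb (head G \<alpha>) (c::'k::field) b (rsz_arrow G \<alpha>) = b \<alpha>"
proof -
  show "i \<in> verts G \<Longrightarrow> dual_comb i (c::'k::field) b (rsz_vertex G i) = c"
    by (simp add: dual_comb_def right_proj_vertex coeff_rsz_vertex)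
  assume \<alpha>: "\<alpha> \<in> arcs G"
  have "(\<Sum>\<beta> | \<beta> \<in> arcs G \<and> head G \<beta> = head G \<alpha>. b \<beta> * acoeff (rsz_arrow G \<alpha>) \<beta>) =
      (\<Sum>\<beta> | \<beta> \<in> arcs G \<and> head G \<beta> = head G \<alpha>. if \<beta> = \<alpha> then b \<alpha> else 0)"
    using \<alpha> by (intro sum.cong) (auto simp: coeff_rsz_arrow)
  also have "\<dots> = b \<alpha>" using \<alpha> by simp
  finally show "dual_comb (head G \<alpha>) (c::'k::field) b (rsz_arrow G \<alpha>) = b \<alpha>"
    using \<alpha> by (simp add: dual_comb_def right_proj_arrow coeff_rsz_arrow)
qed

lemma vertex_dual_eq:
  assumes i: "i \<in> verts G"
  shows "vertex_dual G i = (dual_comb i 1 (\<lambda>_. 0) :: ('a, 'b, 'k::field) rsz \<Rightarrow> 'k)"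
  unfolding vertex_dual_def dual_elem_def
proof (rule the_equality)
  let ?P = "\<lambda>\<phi> :: ('a, 'b, 'k::field) rsz \<Rightarrow> 'k. \<phi> \<in> carrier (inj_module G i) \<and>
    (\<forall>c\<in>right_proj_basis G i. \<phi> c = (if c = rsz_vertex G i then 1 else 0))"
  \<comment> \<open>The dual basis condition compares classes in A, so the arrows must differ from
    the vertex there; their vertex coefficients at \<open>i\<close> tell them apart.\<close>
  have ne: "rsz_arrow G \<alpha> \<noteq> (rsz_vertex G i :: ('a, 'b, 'k) rsz)" if "\<alpha> \<in> arcs G" for \<alpha>
  proof
    assume "rsz_arrow G \<alpha> = (rsz_vertex G i :: ('a, 'b, 'k) rsz)"
    then have "vcoeff (rsz_arrow G \<alpha> :: ('a, 'b, 'k) rsz) i = vcoeff (rsz_vertex G i) i" by simp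
    then show False using that i by (simp add: coeff_rsz_arrow coeff_rsz_vertex)
  qed
  show P: "?P (dual_comb i 1 (\<lambda>_. 0))"
    using ne i dual_comb_basis(2)[of _ "1::'k" "\<lambda>_. 0"]
    by (auto simp: right_proj_basis_def dual_comb_closed dual_comb_basis)
  fix \<phi> assume \<phi>: "?P \<phi>"
  show "\<phi> = dual_comb i 1 (\<lambda>_. 0)"
    using \<phi> P ne by (intro inj_module_eqI[OF i]) (auto simp: right_proj_basis_def)
qed

lemma vertex_dual_closed: "i \<in> verts G \<Longrightarrow> vertex_dual G i \<in> carrier (inj_module G i)"
  by (simp add: vertex_dual_eq dual_comb_closed)

lemma vertex_dual_apply:
  "i \<in> verts G \<Longrightarrow> X \<in> right_proj G i \<Longrightarrow> vertex_dual G i X = (vcoeff X i :: 'k::field)"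
  by (simp add: vertex_dual_eq dual_comb_def)

end

section \<open>Coproducts\<close>

lemma coproduct_simps:
  "x \<oplus>\<^bsub>coproduct I M\<^esub> y = (\<lambda>i\<in>I. x i \<oplus>\<^bsub>M i\<^esub> y i)"
  "\<zero>\<^bsub>coproduct I M\<^esub> = (\<lambda>i\<in>I. \<zero>\<^bsub>M i\<^esub>)"
  "a \<odot>\<^bsub>coproduct I M\<^esub> x = (\<lambda>i\<in>I. a \<odot>\<^bsub>M i\<^esub> x i)"
  by (simp_all add: coproduct_def)

lemma carrier_coproduct:
  "x \<in> carrier (coproduct I M) \<longleftrightarrow>
    x \<in> extensional I \<and> (\<forall>i\<in>I. x i \<in> carrier (M i)) \<and> finite {i \<in> I. x i \<noteq> \<zero>\<^bsub>M i\<^esub>}"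
  by (auto simp: coproduct_def PiE_def)

text \<open>Guarantees that scalar multiplication does not enlarge the support of an element of a
  coproduct.\<close>

lemma (in left_module) lsmult_zero:
  assumes "a \<in> carrier R" shows "a \<odot>\<^bsub>M\<^esub> \<zero>\<^bsub>M\<^esub> = \<zero>\<^bsub>M\<^esub>"
proof -
  have "a \<odot>\<^bsub>M\<^esub> \<zero>\<^bsub>M\<^esub> \<oplus>\<^bsub>M\<^esub> a \<odot>\<^bsub>M\<^esub> \<zero>\<^bsub>M\<^esub> = a \<odot>\<^bsub>M\<^esub> \<zero>\<^bsub>M\<^esub>"
    using lsmult_r_distr[OF assms M.zero_closed M.zero_closed] by simp
  then show ?thesis using lsmult_closed[OF assms M.zero_closed] by (simp add: M.add.l_cancel_one')
qed

lemma coproduct_left_module: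
  assumes R: "ring R" and M: "\<And>i. i \<in> I \<Longrightarrow> left_module R (M i)"
  shows "left_module R (coproduct I M)"
proof (intro left_module.intro left_module_axioms.intro R)
  have grp: "abelian_group (M i)" if "i \<in> I" for i
    using M[OF that] by (rule left_module.axioms(2))
  note [simp] = abelian_groupE(1,2,5)[OF grp]
  have imp_conj: "(Q \<longrightarrow> P) \<and> Q \<longleftrightarrow> Q \<and> P" for P Q by blast
  have fin2: "finite {i \<in> I. x i \<oplus>\<^bsub>M i\<^esub> y i \<noteq> \<zero>\<^bsub>M i\<^esub>}"
    if "finite {i \<in> I. x i \<noteq> \<zero>\<^bsub>M i\<^esub>}" "finite {i \<in> I. y i \<noteq> \<zero>\<^bsub>M i\<^esub>}" for x y
    by (rule finite_subset[OF _ finite_UnI[OF that]]) auto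
  have minus_zero: "\<ominus>\<^bsub>M i\<^esub> \<zero>\<^bsub>M i\<^esub> = \<zero>\<^bsub>M i\<^esub>" if "i \<in> I" for i
    by (intro abelian_group.minus_equality[OF grp[OF that]]) (use that in auto)
  show "abelian_group (coproduct I M)"
  proof (rule abelian_groupI)
    fix x assume x: "x \<in> carrier (coproduct I M)"
    show "\<zero>\<^bsub>coproduct I M\<^esub> \<oplus>\<^bsub>coproduct I M\<^esub> x = x"
      using x by (auto simp: carrier_coproduct coproduct_simps extensional_def restrict_def fun_eq_iff)
    let ?y = "\<lambda>i\<in>I. \<ominus>\<^bsub>M i\<^esub> x i"
    have "{i \<in> I. ?y i \<noteq> \<zero>\<^bsub>M i\<^esub>} \<subseteq> {i \<in> I. x i \<noteq> \<zero>\<^bsub>M i\<^esub>}"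
      by (auto simp: minus_zero)
    then have "finite {i \<in> I. ?y i \<noteq> \<zero>\<^bsub>M i\<^esub>}"
      by (rule finite_subset) (use x in \<open>simp add: carrier_coproduct\<close>)
    then have "?y \<in> carrier (coproduct I M)"
      using x unfolding carrier_coproduct by (simp add: abelian_group.a_inv_closed[OF grp])
    then show "\<exists>y\<in>carrier (coproduct I M). y \<oplus>\<^bsub>coproduct I M\<^esub> x = \<zero>\<^bsub>coproduct I M\<^esub>"
      using x by (intro bexI[of _ ?y])
        (auto simp: carrier_coproduct coproduct_simps abelian_group.l_neg[OF grp] fun_eq_iff)
  next
    fix x y z
    assume "x \<in> carrier (coproduct I M)" "y \<in> carrier (coproduct I M)" "z \<in> carrier (coproduct I M)"
    then show "x \<oplus>\<^bsub>coproduct I M\<^esub> y \<oplus>\<^bsub>coproduct I M\<^esub> z =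
        x \<oplus>\<^bsub>coproduct I M\<^esub> (y \<oplus>\<^bsub>coproduct I M\<^esub> z)"
      by (auto simp: carrier_coproduct coproduct_simps fun_eq_iff abelian_groupE(3)[OF grp])
  next
    fix x y
    assume "x \<in> carrier (coproduct I M)" "y \<in> carrier (coproduct I M)"
    then show "x \<oplus>\<^bsub>coproduct I M\<^esub> y = y \<oplus>\<^bsub>coproduct I M\<^esub> x"
      by (auto simp: carrier_coproduct coproduct_simps fun_eq_iff abelian_groupE(4)[OF grp])
  qed (auto simp: carrier_coproduct coproduct_simps fin2 imp_conj)
  fix a x assume a: "a \<in> carrier R" and x: "x \<in> carrier (coproduct I M)"
  have "{i \<in> I. a \<odot>\<^bsub>M i\<^esub> x i \<noteq> \<zero>\<^bsub>M i\<^esub>} \<subseteq> {i \<in> I. x i \<noteq> \<zero>\<^bsub>M i\<^esub>}"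
    using a by (auto simp: left_module.lsmult_zero[OF M])
  then have "finite {i \<in> I. a \<odot>\<^bsub>M i\<^esub> x i \<noteq> \<zero>\<^bsub>M i\<^esub>}"
    by (rule finite_subset) (use x in \<open>simp add: carrier_coproduct\<close>)
  then show "a \<odot>\<^bsub>coproduct I M\<^esub> x \<in> carrier (coproduct I M)"
    using a x by (auto simp: carrier_coproduct coproduct_simps left_module.lsmult_closed[OF M] imp_conj)
qed (auto simp: carrier_coproduct coproduct_simps fun_eq_iff restrict_def extensional_def
    left_module.lsmult_l_distr[OF M] left_module.lsmult_r_distr[OF M]
    left_module.lsmult_assoc[OF M] left_module.lsmult_one[OF M])

lemma coproduct_inj_closed:
  assumes "j \<in> I" "m \<in> carrier (M j)"
    and "\<And>i. i \<in> I \<Longrightarrow> \<zero>\<^bsub>M i\<^esub> \<in> carrier (M i)"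
  shows "coproduct_inj I M j m \<in> carrier (coproduct I M)"
proof -
  have "{i \<in> I. coproduct_inj I M j m i \<noteq> \<zero>\<^bsub>M i\<^esub>} \<subseteq> {j}"
    by (auto simp: coproduct_inj_def)
  then have "finite {i \<in> I. coproduct_inj I M j m i \<noteq> \<zero>\<^bsub>M i\<^esub>}"
    by (rule finite_subset) simp
  then show ?thesis
    using assms unfolding carrier_coproduct by (auto simp: coproduct_inj_def)
qed

section \<open>The injective Leavitt complex\<close>

text \<open>Meant for evaluations \<open>\<lambda>x. x i z X\<close>, which carry sums in the
  complex to sums in the field. An infinite index set is harmless: both kinds of sum are then zero
  by convention.\<close>

lemma (in abelian_group) additive_finsum:
  fixes h :: "'a \<Rightarrow> 'k::field"
  assumes add: "\<And>x y. x \<in> carrier G \<Longrightarrow> y \<in> carrier G \<Longrightarrow> h (x \<oplus> y) = h x + h y"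
    and f: "f \<in> S \<rightarrow> carrier G"
  shows "h (finsum G f S) = (\<Sum>a\<in>S. h (f a))"
proof -
  have "h \<zero> = h \<zero> + h \<zero>" using add[of \<zero> \<zero>] by simp
  then have h0: "h \<zero> = 0" by (metis add_cancel_right_right)
  show ?thesis
  proof (cases "finite S")
    case True
    then show ?thesis
      using f by (induction S rule: finite_induct) (auto simp: h0 add finsum_insert)
  next
    case False
    then show ?thesis by (simp add: h0 finsum_infinite)
  qed
qed

lemma (in abelian_group) additive_minus:
  fixes h :: "'a \<Rightarrow> 'k::field"
  assumes add: "\<And>x y. x \<in> carrier G \<Longrightarrow> y \<in> carrier G \<Longrightarrow> h (x \<oplus> y) = h x + h y"
    and x: "x \<in> carrier G" and y: "y \<in> carrier G"
  shows "h (x \<ominus> y) = h x - h y"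
proof -
  have "x = (x \<ominus> y) \<oplus> y" using x y by (simp add: minus_eq a_assoc l_neg)
  then have "h x = h (x \<ominus> y) + h y" using x y by (metis add minus_closed)
  then show ?thesis by simp
qed

context fin_digraph
begin

section \<open>Components of elements of the complex\<close>

lemma leavitt_copower_left_module:
  assumes "i \<in> verts G"
  shows "left_module A (leavitt_copower G sp l i :: (('a, 'b, 'k::field) rsz, _) module)"
  unfolding leavitt_copower_def
  by (intro coproduct_left_module rsz_algebra_ring inj_module_left_module assms)

lemma leavitt_left_module:
  "left_module A (leavitt_module G sp l :: (('a, 'b, 'k::field) rsz, _) module)"
  unfolding leavitt_module_def
  by (intro coproduct_left_module rsz_algebra_ring leavitt_copower_left_module)

lemma leavitt_abelian_group:
  "abelian_group (leavitt_module G sp l :: (('a, 'b, 'k::field) rsz, _) module)"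
  using leavitt_left_module by (rule left_module.axioms(2))

text \<open>The outer coproduct runs over the finite vertex set, so only the inner support condition
  remains.\<close>

lemma carrier_leavitt:
  "x \<in> carrier (leavitt_module G sp l) \<longleftrightarrow>
    x \<in> extensional (verts G) \<and> (\<forall>i\<in>verts G. x i \<in> extensional (adm_pairs G sp l i) \<and>
      (\<forall>z\<in>adm_pairs G sp l i. x i z \<in> carrier (inj_module G i)) \<and>
      finite {z \<in> adm_pairs G sp l i. x i z \<noteq> \<zero>\<^bsub>inj_module G i\<^esub>})"
  by (auto simp: leavitt_module_def leavitt_copower_def carrier_coproduct)

lemma leavitt_component:
  "x \<in> carrier (leavitt_module G sp l) \<Longrightarrow> i \<in> verts G \<Longrightarrow> z \<in> adm_pairs G sp l i \<Longrightarrow>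
    x i z \<in> carrier (inj_module G i)"
  by (simp add: carrier_leavitt)

lemma leavitt_apply:
  assumes "i \<in> verts G" "z \<in> adm_pairs G sp l i" "X \<in> right_proj G i"
  shows "(x \<oplus>\<^bsub>leavitt_module G sp l\<^esub> y) i z X = x i z X + (y i z X :: 'k::field)"
    and "\<zero>\<^bsub>leavitt_module G sp l\<^esub> i z X = (0 :: 'k::field)"
    and "(a \<odot>\<^bsub>leavitt_module G sp l\<^esub> x) i z X = (x i z (X \<otimes>\<^bsub>A\<^esub> a) :: 'k::field)"
  using assms
  by (simp_all add: leavitt_module_def leavitt_copower_def coproduct_simps inj_module_simps)

lemma leavitt_eqI:
  assumes x: "x \<in> carrier (leavitt_module G sp l)" and y: "y \<in> carrier (leavitt_module G sp l)"
    and eq: "\<And>i z X. i \<in> verts G \<Longrightarrow> z \<in> adm_pairs G sp l i \<Longrightarrow> X \<in> right_proj G i \<Longrightarrow>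
      x i z X = (y i z X :: 'k::field)"
  shows "x = y"
proof (rule extensionalityI[of _ "verts G"])
  fix i assume i: "i \<in> verts G"
  show "x i = y i"
  proof (rule extensionalityI[of _ "adm_pairs G sp l i"])
    fix z assume z: "z \<in> adm_pairs G sp l i"
    show "x i z = y i z"
      by (rule extensionalityI[of _ "right_proj G i"])
        (use leavitt_component[OF x i z] leavitt_component[OF y i z] eq[OF i z]
          in \<open>auto simp: carrier_inj_module\<close>)
  qed (use x y i in \<open>auto simp: carrier_leavitt\<close>)
qed (use x y in \<open>auto simp: carrier_leavitt\<close>)

lemma leavitt_finsum_apply:
  assumes "i \<in> verts G" "z \<in> adm_pairs G sp l i" "X \<in> right_proj G i"
    and f: "f \<in> S \<rightarrow> carrier (leavitt_module G sp l)"
  shows "finsum (leavitt_module G sp l) f S i z X = (\<Sum>a\<in>S. f a i z X :: 'k::field)"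
  using abelian_group.additive_finsum[OF leavitt_abelian_group _ f, of "\<lambda>x. x i z X"]
  by (simp add: leavitt_apply(1)[OF assms(1-3)])

lemma leavitt_minus_apply:
  assumes "i \<in> verts G" "z \<in> adm_pairs G sp l i" "X \<in> right_proj G i"
    and "x \<in> carrier (leavitt_module G sp l)" "y \<in> carrier (leavitt_module G sp l)"
  shows "(x \<ominus>\<^bsub>leavitt_module G sp l\<^esub> y) i z X = (x i z X - y i z X :: 'k::field)"
  using abelian_group.additive_minus[OF leavitt_abelian_group _ assms(4,5), of "\<lambda>x. x i z X"]
  by (simp add: leavitt_apply(1)[OF assms(1-3)])

text \<open>When one of the two paths is trivial, equality of targets already says which trivial
  path it is. The three clauses of admissibility thus merge into a common target and no common
  special last arrow.\<close>

lemma adm_pairs_iff: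
  "((u, ps), (v, qs)) \<in> adm_pairs G sp l i \<longleftrightarrow>
    (u, ps) \<in> paths G \<and> (v, qs) \<in> paths G \<and> int (length qs) - int (length ps) = l \<and> v = i \<and>
    tgt G (u, ps) = tgt G (v, qs) \<and>
    (ps = [] \<or> qs = [] \<or> last ps \<noteq> last qs \<or> \<not> special G sp (last ps))"
  by (auto simp: adm_pairs_def admissible_def triv_path_def len_def src_def tgt_conv Suc_le_eq)

lemma adm_pairs_src: "z \<in> adm_pairs G sp l i \<Longrightarrow> src (snd z) = i \<and> i \<in> verts G"
  by (cases z; cases "fst z"; cases "snd z") (auto simp: adm_pairs_iff src_def paths_fst)

text \<open>An admissible \<open>z\<close> determines its vertex \<open>i\<close> as the source of
  its second path, so a test on \<open>z\<close> alone singles out the component.\<close>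

lemma leavitt_zeta:
  assumes pq: "(p, q) \<in> adm_pairs G sp l (src q)"
    and m: "m \<in> carrier (inj_module G (src q))"
  shows leavitt_zeta_closed: "leavitt_zeta G sp l m p q \<in> carrier (leavitt_module G sp l)"
    and leavitt_zeta_apply: "\<And>i z X. i \<in> verts G \<Longrightarrow> z \<in> adm_pairs G sp l i \<Longrightarrow> X \<in> right_proj G i \<Longrightarrow>
      leavitt_zeta G sp l m p q i z X = (if z = (p, q) then m X else (0 :: 'k::field))"
proof -
  have i: "src q \<in> verts G" using adm_pairs_src[OF pq] by simp
  have zero: "\<zero>\<^bsub>inj_module G i\<^esub> \<in> carrier (inj_module G i)"
      "\<zero>\<^bsub>leavitt_copower G sp l i\<^esub> \<in> carrier (leavitt_copower G sp l i)"
    if "i \<in> verts G" for i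
    using that inj_module_left_module leavitt_copower_left_module
    by (blast intro: abelian_groupE(2) left_module.axioms(2))+
  show "leavitt_zeta G sp l m p q \<in> carrier (leavitt_module G sp l)"
    unfolding leavitt_zeta_def leavitt_module_def
    by (intro coproduct_inj_closed i zero)
      (simp_all add: leavitt_copower_def coproduct_inj_closed pq m zero i)
  fix i z and X :: "('a, 'b, 'k) rsz"
  assume "i \<in> verts G" "z \<in> adm_pairs G sp l i" "X \<in> right_proj G i"
  then show "leavitt_zeta G sp l m p q i z X = (if z = (p, q) then m X else 0)"
    using adm_pairs_src[of z sp l i]
    by (auto simp: leavitt_zeta_def coproduct_inj_def leavitt_copower_def coproduct_simps
        inj_module_simps)
qed

end

section \<open>Admissible pairs under the differential and its inverse\<close>

locale special_quiver = fin_digraph G for G :: "('a, 'b) pre_digraph" +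
  fixes sp :: "'a \<Rightarrow> 'b"
  assumes sp: "special_choice G sp"
begin

lemma sp_arc: "i \<in> verts G \<Longrightarrow> sp i \<in> arcs G" and tail_sp [simp]: "i \<in> verts G \<Longrightarrow> tail G (sp i) = i"
  using sp by (auto simp: special_choice_def)

lemma special_iff: "special G sp \<alpha> \<longleftrightarrow> \<alpha> \<in> arcs G \<and> sp (tail G \<alpha>) = \<alpha>"
  by (auto simp: special_def)

abbreviation L :: "int \<Rightarrow> (('a, 'b, 'k::field) rsz, ('a, 'b, 'k) leavitt_elem) module" where
  "L \<equiv> leavitt_module G sp"

abbreviation B :: "int \<Rightarrow> 'a \<Rightarrow> (('a, 'b) qpath \<times> ('a, 'b) qpath) set" where
  "B \<equiv> adm_pairs G sp"

text \<open>The exceptional case in the definition of $\<partial>(\<alpha>^\<sharp>\<zeta>_{(p,q)})$, for \<open>ps\<close> and \<open>qs\<close> the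
  arrow lists of $p$ and $q$.\<close>

definition folds :: "'b \<Rightarrow> 'b list \<Rightarrow> 'b list \<Rightarrow> bool" where
  "folds \<alpha> ps qs \<longleftrightarrow> qs = [] \<and> ps \<noteq> [] \<and> last ps = \<alpha> \<and> special G sp \<alpha>"

text \<open>The new arrow is traversed first, so for nontrivial q the last arrow is unchanged. For
  trivial q it becomes the last arrow, and excluding \<open>folds\<close> is then precisely what
  admissibility asks.\<close>

lemma adm_pairs_push:
  assumes "\<alpha> \<in> arcs G" "((u, ps), (v, qs)) \<in> B l (head G \<alpha>)" "\<not> folds \<alpha> ps qs"
  shows "((u, ps), (tail G \<alpha>, \<alpha> # qs)) \<in> B (l + 1) (tail G \<alpha>)"
  using assms by (auto simp: adm_pairs_iff folds_def tgt_conv)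

lemma adm_pairs_trunc:
  assumes "((u, rs @ [\<alpha>]), (v, [])) \<in> B l i"
  shows "((u, rs), (tail G \<alpha>, [])) \<in> B (l + 1) (tail G \<alpha>)"
  using assms paths_tgt[of u rs] by (auto simp: adm_pairs_iff tgt_conv)

text \<open>Both paths end in \<beta>, which is allowed because \<beta> shares its start with the
  special arrow \<alpha> and therefore cannot be special.\<close>

lemma adm_pairs_turn:
  assumes "((u, rs @ [\<alpha>]), (v, [])) \<in> B l i" "special G sp \<alpha>" "\<beta> \<in> siblings G \<alpha>"
  shows "((u, rs @ [\<beta>]), (tail G \<beta>, [\<beta>])) \<in> B (l + 1) (tail G \<beta>)"
  using assms by (auto simp: adm_pairs_iff tgt_conv siblings_def special_def)

lemma adm_pairs_extend:
  assumes "((u, ps), (v, [])) \<in> B (l + 1) i" "\<alpha> \<in> arcs G" "tail G \<alpha> = v"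
  shows "((u, ps @ [\<alpha>]), (head G \<alpha>, [])) \<in> B l (head G \<alpha>)"
  using assms by (auto simp: adm_pairs_iff tgt_conv)

text \<open>Inverts \<open>adm_pairs_push\<close>. The last claim holds because otherwise both paths
  of the given pair would end in the same special arrow.\<close>

lemma adm_pairs_pop:
  assumes "((u, ps), (v, b # qs)) \<in> B (l + 1) i"
  shows "b \<in> arcs G" "tail G b = i" "v = i" "((u, ps), (head G b, qs)) \<in> B l (head G b)"
    "\<not> folds b ps qs"
  using assms by (auto simp: adm_pairs_iff tgt_conv folds_def)

text \<open>A pair (\<beta> r, \<beta>) can be reached in a second way, as a sibling term in the
  exceptional rule. With \<alpha> the special arrow at v this is the pair it is reached
  from.\<close>

lemma adm_pairs_swap:
  assumes w: "((u, ps), (v, b # bs)) \<in> B (l + 1) i" and c: "bs = [] \<and> ps \<noteq> [] \<and> last ps = b"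
    and \<alpha>: "\<alpha> \<in> arcs G" "tail G \<alpha> = v"
  shows "((u, butlast ps @ [\<alpha>]), (head G \<alpha>, [])) \<in> B l (head G \<alpha>)"
proof -
  obtain rs where ps: "ps = rs @ [b]" using c by (metis append_butlast_last_id)
  show ?thesis using w conjunct1[OF c] \<alpha> unfolding ps by (auto simp: adm_pairs_iff tgt_conv)
qed

section \<open>The differential in coordinates\<close>

text \<open>\<open>inc \<alpha> z w\<close> is the coefficient of $e_i^\<sharp>\<zeta>_w$ in $\<partial>(\<alpha>^\<sharp>\<zeta>_z)$.\<close>

fun inc :: "'b \<Rightarrow> ('a, 'b) qpath \<times> ('a, 'b) qpath \<Rightarrow> ('a, 'b) qpath \<times> ('a, 'b) qpath \<Rightarrow> 'k::field" where
  "inc \<alpha> ((u, ps), (v, qs)) w =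
    (if folds \<alpha> ps qs
     then (if w = ((u, butlast ps), (tail G \<alpha>, [])) then 1 else 0) -
       (\<Sum>\<beta>\<in>siblings G \<alpha>. if w = ((u, butlast ps @ [\<beta>]), (tail G \<beta>, [\<beta>])) then 1 else 0)
     else (if w = ((u, ps), (tail G \<alpha>, \<alpha> # qs)) then 1 else 0))"

text \<open>Every term is a multiple of some e_i^\<sharp>\<zeta>_w, and e_i^\<sharp> reads off the
  vertex coefficient. Hence \<open>X\<close> enters only through \<open>vcoeff X i\<close>, and the
  rest is the combinatorial number \<open>inc\<close>.\<close>

lemma leavitt_diff_arrow:
  assumes \<alpha>: "\<alpha> \<in> arcs G" and z: "z \<in> B l (head G \<alpha>)"
  shows leavitt_diff_arrow_closed:
      "leavitt_diff_arrow G sp l \<alpha> (fst z) (snd z) \<in> carrier (L (l + 1) :: (('a, 'b, 'k::field) rsz, _) module)"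
    and leavitt_diff_arrow_apply: "\<And>i w X. i \<in> verts G \<Longrightarrow> w \<in> B (l + 1) i \<Longrightarrow> X \<in> right_proj G i \<Longrightarrow>
      leavitt_diff_arrow G sp l \<alpha> (fst z) (snd z) i w X = inc \<alpha> z w * (vcoeff X i :: 'k)"
proof -
  obtain u ps v qs where zz: "z = ((u, ps), (v, qs))" by (cases z) auto
  have t: "tail G \<alpha> \<in> verts G" using \<alpha> by simp
  let ?d = "leavitt_diff_arrow G sp l \<alpha> (fst z) (snd z) :: ('a, 'b, 'k) leavitt_elem"
  have "?d \<in> carrier (L (l + 1)) \<and> (\<forall>i w X. i \<in> verts G \<longrightarrow> w \<in> B (l + 1) i \<longrightarrow> X \<in> right_proj G i \<longrightarrow>
      ?d i w X = inc \<alpha> z w * vcoeff X i)"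
  proof (cases "folds \<alpha> ps qs")
    case True
    then obtain rs where ps: "ps = rs @ [\<alpha>]" "qs = []" "special G sp \<alpha>"
      by (metis folds_def append_butlast_last_id)
    let ?Z = "\<lambda>p q. leavitt_zeta G sp (l + 1) (vertex_dual G (tail G \<alpha>)) p q :: ('a, 'b, 'k) leavitt_elem"
    let ?m = "?Z (u, rs) (tail G \<alpha>, [])"
      and ?s = "\<lambda>\<beta>. ?Z (u, rs @ [\<beta>]) (tail G \<beta>, [\<beta>])"
    have d: "?d = ?m \<ominus>\<^bsub>L (l + 1)\<^esub> (\<Oplus>\<^bsub>L (l + 1)\<^esub>\<beta>\<in>siblings G \<alpha>. ?s \<beta>)"
      using ps by (simp add: zz leavitt_diff_arrow_def len_def trunc_def triv_path_def path_comp_def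
          arrow_path_def src_def Let_def)
    have m: "((u, rs), (tail G \<alpha>, [])) \<in> B (l + 1) (src (tail G \<alpha>, []))"
      using adm_pairs_trunc[of u rs \<alpha> v l] z zz ps by (simp add: src_def)
    have s: "((u, rs @ [\<beta>]), (tail G \<beta>, [\<beta>])) \<in> B (l + 1) (src (tail G \<beta>, [\<beta>]))"
        "tail G \<beta> = tail G \<alpha>" if "\<beta> \<in> siblings G \<alpha>" for \<beta>
      using adm_pairs_turn[of u rs \<alpha> v l _ \<beta>] z zz ps that by (auto simp: src_def siblings_def)
    have mc: "?m \<in> carrier (L (l + 1))"
      using t by (intro leavitt_zeta_closed m) (simp add: src_def vertex_dual_closed)
    have sc: "?s \<in> siblings G \<alpha> \<rightarrow> carrier (L (l + 1))"
      using t s by (intro funcsetI leavitt_zeta_closed s) (auto simp: src_def vertex_dual_closed)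
    have sumc: "(\<Oplus>\<^bsub>L (l + 1)\<^esub>\<beta>\<in>siblings G \<alpha>. ?s \<beta>) \<in> carrier (L (l + 1))"
      using sc by (intro abelian_monoid.finsum_closed[OF abelian_group.axioms(1)[OF leavitt_abelian_group]])
    have "?d i w X = inc \<alpha> z w * vcoeff X i"
      if i: "i \<in> verts G" "w \<in> B (l + 1) i" "X \<in> right_proj G i" for i w X
    proof -
      \<comment> \<open>The component index is the source of the second path of \<open>w\<close>,
        hence the start of \<alpha> for every pair produced by the differential.\<close>
      have j: "X \<in> right_proj G (tail G \<alpha>)" "i = tail G \<alpha>" if "w = (p, (tail G \<alpha>, qs))" for p qs
        using adm_pairs_src[OF i(2)] i(3) that by (auto simp: src_def)
      have m': "?m i w X = (if w = ((u, rs), (tail G \<alpha>, [])) then 1 else 0) * vcoeff X i"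
        using t j i by (subst leavitt_zeta_apply[OF m]) (auto simp: src_def vertex_dual_closed vertex_dual_apply)
      have s': "?s \<beta> i w X = (if w = ((u, rs @ [\<beta>]), (tail G \<beta>, [\<beta>])) then 1 else 0) * vcoeff X i"
        if \<beta>: "\<beta> \<in> siblings G \<alpha>" for \<beta>
        using t j i s(2)[OF \<beta>]
        by (subst leavitt_zeta_apply[OF s(1)[OF \<beta>]]) (auto simp: src_def vertex_dual_closed vertex_dual_apply)
      have "?d i w X = ?m i w X - (\<Sum>\<beta>\<in>siblings G \<alpha>. ?s \<beta> i w X)"
        unfolding d by (simp add: leavitt_minus_apply[OF i mc sumc] leavitt_finsum_apply[OF i sc])
      also have "(\<Sum>\<beta>\<in>siblings G \<alpha>. ?s \<beta> i w X) = (\<Sum>\<beta>\<in>siblings G \<alpha>.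
          (if w = ((u, rs @ [\<beta>]), (tail G \<beta>, [\<beta>])) then 1 else 0) * vcoeff X i)"
        by (rule sum.cong) (auto simp: s')
      finally show ?thesis
        unfolding m' using True ps by (simp add: zz left_diff_distrib sum_distrib_right)
    qed
    moreover have "?d \<in> carrier (L (l + 1))"
      unfolding d by (intro abelian_group.minus_closed[OF leavitt_abelian_group] mc sumc)
    ultimately show ?thesis by blast
  next
    case False
    have d: "?d = leavitt_zeta G sp (l + 1) (vertex_dual G (tail G \<alpha>)) (u, ps) (tail G \<alpha>, \<alpha> # qs)"
      using False by (auto simp: zz leavitt_diff_arrow_def len_def folds_def path_comp_def
          arrow_path_def src_def Let_def Suc_le_eq)
    have m: "((u, ps), (tail G \<alpha>, \<alpha> # qs)) \<in> B (l + 1) (src (tail G \<alpha>, \<alpha> # qs))"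
      using adm_pairs_push[OF \<alpha> z[unfolded zz] False] by (simp add: src_def)
    have "?d \<in> carrier (L (l + 1))"
      unfolding d using t by (intro leavitt_zeta_closed m) (simp add: src_def vertex_dual_closed)
    moreover have "?d i w X = inc \<alpha> z w * vcoeff X i"
      if i: "i \<in> verts G" "w \<in> B (l + 1) i" "X \<in> right_proj G i" for i w X
    proof -
      have j: "X \<in> right_proj G (tail G \<alpha>)" "i = tail G \<alpha>" if "w = (p, (tail G \<alpha>, qs))" for p qs
        using adm_pairs_src[OF i(2)] i(3) that by (auto simp: src_def)
      show ?thesis
        unfolding d using t i j False
        by (subst leavitt_zeta_apply[OF m]) (auto simp: zz src_def vertex_dual_closed vertex_dual_apply)
    qed
    ultimately show ?thesis by blast
  qed
  then show "?d \<in> carrier (L (l + 1))"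
    and "\<And>i w X. i \<in> verts G \<Longrightarrow> w \<in> B (l + 1) i \<Longrightarrow> X \<in> right_proj G i \<Longrightarrow>
      ?d i w X = inc \<alpha> z w * vcoeff X i" by blast+
qed

text \<open>The coefficient of $e_i^\<sharp>\<zeta>_w$ in $\<partial> x$.\<close>

fun bdry :: "('a, 'b, 'k::field) leavitt_elem \<Rightarrow> ('a, 'b) qpath \<times> ('a, 'b) qpath \<Rightarrow> 'k" where
  "bdry x ((u, ps), (v, [])) =
    x (head G (sp v)) ((u, ps @ [sp v]), (head G (sp v), [])) (rsz_arrow G (sp v))"
| "bdry x ((u, ps), (v, b # qs)) =
    x (head G b) ((u, ps), (head G b, qs)) (rsz_arrow G b) -
    (if qs = [] \<and> ps \<noteq> [] \<and> last ps = b
     then x (head G (sp v)) ((u, butlast ps @ [sp v]), (head G (sp v), [])) (rsz_arrow G (sp v))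
     else 0)"

text \<open>The pair \<open>w\<close> determines \<beta>, so at most one summand is nonzero.\<close>

lemma sum_siblings:
  "(\<Sum>\<beta>\<in>siblings G \<alpha>. if w = ((u, rs @ [\<beta>]), (tail G \<beta>, [\<beta>])) then 1 else 0) =
    (if \<exists>\<beta>\<in>siblings G \<alpha>. w = ((u, rs @ [\<beta>]), (tail G \<beta>, [\<beta>])) then 1 else (0::'k::field))"
proof (cases "\<exists>\<beta>\<in>siblings G \<alpha>. w = ((u, rs @ [\<beta>]), (tail G \<beta>, [\<beta>]))")
  case True
  then obtain \<gamma> where \<gamma>: "\<gamma> \<in> siblings G \<alpha>" "w = ((u, rs @ [\<gamma>]), (tail G \<gamma>, [\<gamma>]))" by blast
  have "finite (siblings G \<alpha>)" by (simp add: siblings_def)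
  moreover have "(\<Sum>\<beta>\<in>siblings G \<alpha>. if w = ((u, rs @ [\<beta>]), (tail G \<beta>, [\<beta>])) then 1 else 0) =
      (\<Sum>\<beta>\<in>siblings G \<alpha>. if \<beta> = \<gamma> then 1 else (0::'k))"
    using \<gamma>(2) by (intro sum.cong) auto
  ultimately show ?thesis using True \<gamma>(1) by simp
next
  case False
  then show ?thesis by (auto intro: sum.neutral)
qed

text \<open>The ordinary rule and the sibling terms always yield a second path of positive length. A
  trivial second path can therefore only be the leading term of the exceptional rule, with \<alpha>
  the special arrow at v.\<close>

lemma inc_Nil:
  assumes \<alpha>: "\<alpha> \<in> arcs G" and z: "z \<in> B l (head G \<alpha>)" and w: "((u, ps), (v, [])) \<in> B (l + 1) i"
  shows "inc \<alpha> z ((u, ps), (v, [])) =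
    (if \<alpha> = sp v \<and> z = ((u, ps @ [sp v]), (head G (sp v), [])) then 1 else (0::'k::field))"
proof -
  obtain u' ps' v' qs' where zz: "z = ((u', ps'), (v', qs'))" by (cases z) auto
  have v: "v \<in> verts G" "v' = head G \<alpha>" using w z by (auto simp: adm_pairs_iff zz)
  have sib: "\<not> (\<exists>\<beta>\<in>siblings G \<alpha>. ((u, ps), (v, [])) = ((u', butlast ps' @ [\<beta>]), (tail G \<beta>, [\<beta>])))"
    by auto
  show ?thesis
  proof (cases "folds \<alpha> ps' qs'")
    case True
    then obtain rs where ps: "ps' = rs @ [\<alpha>]" "qs' = []" "sp (tail G \<alpha>) = \<alpha>"
      by (metis folds_def append_butlast_last_id special_iff)
    have "(u = u' \<and> ps = rs \<and> v = tail G \<alpha>) =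
        (\<alpha> = sp v \<and> z = ((u, ps @ [sp v]), (head G (sp v), [])))"
      using ps v tail_sp[OF v(1)] by (auto simp: zz)
    then show ?thesis using True sib by (simp add: zz sum_siblings ps del: tail_sp)
  next
    case False
    moreover have "folds \<alpha> ps' qs'" if "\<alpha> = sp v" "z = ((u, ps @ [sp v]), (head G (sp v), []))"
      using that \<alpha> v by (auto simp: zz folds_def special_iff)
    ultimately show ?thesis by (auto simp: zz)
  qed
qed

text \<open>Two origins are possible: undoing the ordinary rule by removing the first arrow b of the
  second path, and, for w = (b r, b), a sibling term produced by the special arrow at v.\<close>

lemma inc_Cons:
  assumes \<alpha>: "\<alpha> \<in> arcs G" and z: "z \<in> B l (head G \<alpha>)" and w: "((u, ps), (v, b # qs)) \<in> B (l + 1) i"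
  shows "inc \<alpha> z ((u, ps), (v, b # qs)) =
    (if \<alpha> = b \<and> z = ((u, ps), (head G b, qs)) then 1 else 0) -
    (if qs = [] \<and> ps \<noteq> [] \<and> last ps = b \<and> \<alpha> = sp v \<and>
      z = ((u, butlast ps @ [sp v]), (head G (sp v), [])) then 1 else (0::'k::field))"
proof -
  obtain u' ps' v' qs' where zz: "z = ((u', ps'), (v', qs'))" by (cases z) auto
  have v': "v' = head G \<alpha>" using z by (auto simp: adm_pairs_iff zz)
  note b = adm_pairs_pop[OF w]
  have v: "v \<in> verts G" "v = tail G b" using b by auto
  show ?thesis
  proof (cases "folds \<alpha> ps' qs'")
    case True
    then obtain rs where ps: "ps' = rs @ [\<alpha>]" "qs' = []" "sp (tail G \<alpha>) = \<alpha>" "special G sp \<alpha>"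
      by (metis folds_def append_butlast_last_id special_iff)
    have 1: "\<not> (\<alpha> = b \<and> z = ((u, ps), (head G b, qs)))"
      using b(5) True by (auto simp: zz)
    have 2: "(\<exists>\<beta>\<in>siblings G \<alpha>. ((u, ps), (v, b # qs)) = ((u', rs @ [\<beta>]), (tail G \<beta>, [\<beta>]))) =
      (qs = [] \<and> ps \<noteq> [] \<and> last ps = b \<and> \<alpha> = sp v \<and> z = ((u, butlast ps @ [sp v]), (head G (sp v), [])))"
      (is "?l = ?r")
    proof
      assume ?l
      then have "b \<in> siblings G \<alpha>" "u = u'" "ps = rs @ [b]" "qs = []" by auto
      then show ?r using ps v v' by (auto simp: zz siblings_def)
    next
      assume r: ?r
      then have "ps = rs @ [b]" "u = u'" using ps by (auto simp: zz)
      \<comment> \<open>Since (p, b) is admissible and p ends in b, the arrow b is not special,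
        whereas \<alpha> is.\<close>
      moreover have "b \<noteq> \<alpha>" using b(5) r ps(4) by (auto simp: folds_def)
      moreover have "tail G \<alpha> = v" using r v by simp
      ultimately show ?l using r v b(1) by (auto simp: siblings_def)
    qed
    have "inc \<alpha> z ((u, ps), (v, b # qs)) = - (\<Sum>\<beta>\<in>siblings G \<alpha>.
        if ((u, ps), (v, b # qs)) = ((u', rs @ [\<beta>]), (tail G \<beta>, [\<beta>])) then 1 else (0::'k))"
      using True by (simp add: zz ps(1))
    then show ?thesis unfolding sum_siblings 2 by (simp only: 1 if_False) simp
  next
    case False
    then have 1: "\<not> (qs = [] \<and> ps \<noteq> [] \<and> last ps = b \<and> \<alpha> = sp v \<and>
        z = ((u, butlast ps @ [sp v]), (head G (sp v), [])))"
      using \<alpha> v(1) by (auto simp: zz folds_def special_iff)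
    have "inc \<alpha> z ((u, ps), (v, b # qs)) =
        (if ((u, ps), (v, b # qs)) = ((u', ps'), (tail G \<alpha>, \<alpha> # qs')) then 1 else (0::'k))"
      using False by (simp add: zz)
    moreover have "((u, ps), (v, b # qs)) = ((u', ps'), (tail G \<alpha>, \<alpha> # qs')) \<longleftrightarrow>
        \<alpha> = b \<and> z = ((u, ps), (head G b, qs))"
      using v(2) v' by (auto simp: zz)
    ultimately show ?thesis by (simp only: 1 if_False) simp
  qed
qed

text \<open>The sum visits only those z where x has a nonzero component. If \<open>z0\<close> is not
  among them, the coefficient on the right vanishes as well, so no case distinction
  survives.\<close>

lemma sum_single_coeff:
  fixes x :: "('a, 'b, 'k::field) leavitt_elem"
  assumes x: "x \<in> carrier (L l)" and \<alpha>: "\<alpha>0 \<in> arcs G" and z: "z0 \<in> B l (head G \<alpha>0)"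
  shows "(\<Sum>i\<in>verts G. \<Sum>z\<in>{z \<in> B l i. x i z \<noteq> \<zero>\<^bsub>inj_module G i\<^esub>}.
      \<Sum>\<alpha>\<in>{\<alpha> \<in> arcs G. head G \<alpha> = i}.
        x i z (rsz_arrow G \<alpha>) * (if \<alpha> = \<alpha>0 \<and> z = z0 then 1 else 0)) =
    x (head G \<alpha>0) z0 (rsz_arrow G \<alpha>0)"
proof -
  let ?h = "head G \<alpha>0" let ?S = "\<lambda>i. {z \<in> B l i. x i z \<noteq> \<zero>\<^bsub>inj_module G i\<^esub>}"
  have h: "?h \<in> verts G" using \<alpha> by simp
  have fin: "finite (?S i)" if "i \<in> verts G" for i using x that by (simp add: carrier_leavitt)
  have "(\<Sum>\<alpha>\<in>{\<alpha> \<in> arcs G. head G \<alpha> = i}.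
        x i z (rsz_arrow G \<alpha>) * (if \<alpha> = \<alpha>0 \<and> z = z0 then 1 else 0)) =
      (\<Sum>\<alpha>\<in>{\<alpha> \<in> arcs G. head G \<alpha> = i}.
        if \<alpha> = \<alpha>0 then (if z = z0 then x i z (rsz_arrow G \<alpha>0) else 0) else 0)" for i z
    by (rule sum.cong) auto
  then have a: "(\<Sum>\<alpha>\<in>{\<alpha> \<in> arcs G. head G \<alpha> = i}.
        x i z (rsz_arrow G \<alpha>) * (if \<alpha> = \<alpha>0 \<and> z = z0 then 1 else 0)) =
      (if z = z0 then (if i = ?h then x i z0 (rsz_arrow G \<alpha>0) else 0) else 0)" for i z
    using \<alpha> by auto
  have b: "(\<Sum>z\<in>?S i. if z = z0 then (if i = ?h then x i z0 (rsz_arrow G \<alpha>0) else 0) else 0) =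
      (if i = ?h then x i z0 (rsz_arrow G \<alpha>0) else 0)" if i: "i \<in> verts G" for i
  proof -
    have "x ?h z0 (rsz_arrow G \<alpha>0) = 0" if "x ?h z0 = \<zero>\<^bsub>inj_module G ?h\<^esub>"
      using right_proj_arrow[OF \<alpha>, where 'k='k] by (simp add: that inj_module_simps)
    then show ?thesis using fin[OF i] z by auto
  qed
  show ?thesis unfolding a using h by (simp add: b cong: sum.cong)
qed

text \<open>Evaluation commutes with the finite sums, so the coefficient at \<open>w\<close> is the
  sum of the coefficients of x weighted by \<open>inc\<close>. By \<open>inc_Nil\<close> and
  \<open>inc_Cons\<close> only one or two terms remain, and these make up
  \<open>bdry\<close>.\<close>

lemma leavitt_diff:
  fixes x :: "('a, 'b, 'k::field) leavitt_elem"
  assumes x: "x \<in> carrier (L l)"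
  shows leavitt_diff_closed: "leavitt_diff G sp l x \<in> carrier (L (l + 1))"
    and leavitt_diff_apply: "\<And>i w X. i \<in> verts G \<Longrightarrow> w \<in> B (l + 1) i \<Longrightarrow> X \<in> right_proj G i \<Longrightarrow>
      leavitt_diff G sp l x i w X = bdry x w * vcoeff X i"
proof -
  let ?S = "\<lambda>i. {z \<in> B l i. x i z \<noteq> \<zero>\<^bsub>inj_module G i\<^esub>}"
  let ?T = "\<lambda>i. {\<alpha> \<in> arcs G. head G \<alpha> = i}"
  let ?f = "\<lambda>i z \<alpha>. rsz_scalar G (x i z (rsz_arrow G \<alpha>)) \<odot>\<^bsub>L (l + 1)\<^esub>
    (leavitt_diff_arrow G sp l \<alpha> (fst z) (snd z) :: ('a, 'b, 'k) leavitt_elem)"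
  have f: "?f i z \<in> ?T i \<rightarrow> carrier (L (l + 1))" if "z \<in> ?S i" for i z
    using that
    by (auto intro!: left_module.lsmult_closed[OF leavitt_left_module] rsz_scalar_closed leavitt_diff_arrow_closed)
  note fc = abelian_monoid.finsum_closed[OF abelian_group.axioms(1)[OF leavitt_abelian_group]]
  have f2: "(\<lambda>z. \<Oplus>\<^bsub>L (l + 1)\<^esub>\<alpha>\<in>?T i. ?f i z \<alpha>) \<in> ?S i \<rightarrow> carrier (L (l + 1))" for i
    by (rule funcsetI, rule fc, rule f)
  have f3: "(\<lambda>i. \<Oplus>\<^bsub>L (l + 1)\<^esub>z\<in>?S i. \<Oplus>\<^bsub>L (l + 1)\<^esub>\<alpha>\<in>?T i. ?f i z \<alpha>) \<in> verts G \<rightarrow> carrier (L (l + 1))"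
    by (rule funcsetI, rule fc, rule f2)
  show "leavitt_diff G sp l x \<in> carrier (L (l + 1))"
    unfolding leavitt_diff_def by (rule fc[OF f3])
  fix j w and X :: "('a, 'b, 'k) rsz"
  assume j: "j \<in> verts G" "w \<in> B (l + 1) j" "X \<in> right_proj G j"
  have f1': "(\<Oplus>\<^bsub>L (l + 1)\<^esub>\<alpha>\<in>?T i. ?f i z \<alpha>) j w X =
      (\<Sum>\<alpha>\<in>?T i. x i z (rsz_arrow G \<alpha>) * inc \<alpha> z w) * vcoeff X j" if z: "z \<in> ?S i" for i z
  proof -
    have "(\<Oplus>\<^bsub>L (l + 1)\<^esub>\<alpha>\<in>?T i. ?f i z \<alpha>) j w X = (\<Sum>\<alpha>\<in>?T i. ?f i z \<alpha> j w X)"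
      by (rule leavitt_finsum_apply[OF j f[OF z]])
    also have "\<dots> = (\<Sum>\<alpha>\<in>?T i. x i z (rsz_arrow G \<alpha>) * inc \<alpha> z w * vcoeff X j)"
      using z j by (intro sum.cong)
        (auto simp: leavitt_apply(3) leavitt_diff_arrow_apply right_proj_mult rsz_scalar_closed
          coeff_mult coeff_rsz_scalar right_proj_carrier)
    finally show ?thesis by (simp add: sum_distrib_right)
  qed
  have "leavitt_diff G sp l x j w X =
      (\<Sum>i\<in>verts G. \<Sum>z\<in>?S i. \<Sum>\<alpha>\<in>?T i. x i z (rsz_arrow G \<alpha>) * inc \<alpha> z w) * vcoeff X j"
    unfolding leavitt_diff_def leavitt_finsum_apply[OF j f3] leavitt_finsum_apply[OF j f2] sum_distrib_right
    by (intro sum.cong refl) (simp only: f1' sum_distrib_right)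
  also have "(\<Sum>i\<in>verts G. \<Sum>z\<in>?S i. \<Sum>\<alpha>\<in>?T i. x i z (rsz_arrow G \<alpha>) * inc \<alpha> z w) = bdry x w"
  proof -
    obtain u ps v qs where ww: "w = ((u, ps), (v, qs))" by (cases w) auto
    have v: "v \<in> verts G" using j by (auto simp: ww adm_pairs_iff)
    note spv = sp_arc[OF v]
    show ?thesis
    proof (cases qs)
      case Nil
      let ?z = "((u, ps @ [sp v]), (head G (sp v), []))"
      have z: "?z \<in> B l (head G (sp v))"
        using j(2) spv v unfolding ww Nil by (intro adm_pairs_extend) auto
      have "(\<Sum>i\<in>verts G. \<Sum>z\<in>?S i. \<Sum>\<alpha>\<in>?T i. x i z (rsz_arrow G \<alpha>) * inc \<alpha> z w) =
        (\<Sum>i\<in>verts G. \<Sum>z\<in>?S i. \<Sum>\<alpha>\<in>?T i. x i z (rsz_arrow G \<alpha>) * (if \<alpha> = sp v \<and> z = ?z then 1 else 0))"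
        using j(2) unfolding ww Nil by (intro sum.cong refl) (auto simp: inc_Nil simp del: inc.simps)
      also have "\<dots> = bdry x w"
        unfolding sum_single_coeff[OF x spv z] by (simp add: ww Nil)
      finally show ?thesis .
    next
      case (Cons b bs)
      let ?z = "((u, ps), (head G b, bs))" and ?z' = "((u, butlast ps @ [sp v]), (head G (sp v), []))"
      let ?c = "bs = [] \<and> ps \<noteq> [] \<and> last ps = b"
      note b = adm_pairs_pop[OF j(2)[unfolded ww Cons]]
      \<comment> \<open>The condition \<open>?c\<close> is separated from the second indicator
        because \<open>?z'\<close> is known to be admissible only when \<open>?c\<close>
        holds.\<close>
      have eq: "inc \<alpha> z w = (if \<alpha> = b \<and> z = ?z then 1 else 0) -
          (if ?c then (if \<alpha> = sp v \<and> z = ?z' then 1 else 0) else (0::'k))"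
        if "\<alpha> \<in> arcs G" "z \<in> B l (head G \<alpha>)" for \<alpha> z
        unfolding ww Cons inc_Cons[OF that j(2)[unfolded ww Cons]] by simp
      have "(\<Sum>i\<in>verts G. \<Sum>z\<in>?S i. \<Sum>\<alpha>\<in>?T i. x i z (rsz_arrow G \<alpha>) * inc \<alpha> z w) =
        (\<Sum>i\<in>verts G. \<Sum>z\<in>?S i. \<Sum>\<alpha>\<in>?T i. x i z (rsz_arrow G \<alpha>) * (if \<alpha> = b \<and> z = ?z then 1 else 0) -
          (if ?c then x i z (rsz_arrow G \<alpha>) * (if \<alpha> = sp v \<and> z = ?z' then 1 else 0) else 0))"
        by (intro sum.cong refl) (auto simp: eq right_diff_distrib simp del: inc.simps)
      also have "\<dots> = x (head G b) ?z (rsz_arrow G b) - (if ?c then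
          (\<Sum>i\<in>verts G. \<Sum>z\<in>?S i. \<Sum>\<alpha>\<in>?T i. x i z (rsz_arrow G \<alpha>) * (if \<alpha> = sp v \<and> z = ?z' then 1 else 0))
          else 0)"
        unfolding sum_subtractf sum_single_coeff[OF x b(1,4)] 
        by (cases ?c) (simp_all only: if_True if_False sum.neutral_const simp_thms)
      also have "\<dots> = bdry x w"
      proof (cases ?c)
        case True
        have "?z' \<in> B l (head G (sp v))"
          by (rule adm_pairs_swap[OF j(2)[unfolded ww Cons] True spv tail_sp[OF v]])
        then show ?thesis using True by (simp add: ww Cons sum_single_coeff[OF x spv])
      next
        case False
        then have "bdry x w = x (head G b) ?z (rsz_arrow G b)" by (auto simp: ww Cons)
        then show ?thesis using False by (simp only: if_False) simp
      qed
      finally show ?thesis .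
    qed
  qed
  finally show "leavitt_diff G sp l x j w X = bdry x w * vcoeff X j" .
qed

text \<open>\<open>bdry\<close> reads x only at arrows starting at \<open>i\<close>, so the relation
  is required only there. This matters for the action of A, where the scalar depends on
  \<open>i\<close>. The choices (1, 1), (scalar, 0) and (0, 0) for c and d give additivity,
  A-linearity and vanishing.\<close>

lemma bdry_linear:
  fixes x y y' :: "('a, 'b, 'k::field) leavitt_elem"
  assumes w: "w \<in> B (l + 1) i"
    and eq: "\<And>\<alpha> z. \<alpha> \<in> arcs G \<Longrightarrow> tail G \<alpha> = i \<Longrightarrow> z \<in> B l (head G \<alpha>) \<Longrightarrow>
      x (head G \<alpha>) z (rsz_arrow G \<alpha>) =
        c * y (head G \<alpha>) z (rsz_arrow G \<alpha>) + d * y' (head G \<alpha>) z (rsz_arrow G \<alpha>)"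
  shows "bdry x w = c * bdry y w + d * bdry y' w"
proof -
  obtain u ps v qs where ww: "w = ((u, ps), (v, qs))" by (cases w) auto
  have v: "v \<in> verts G" "v = i" using adm_pairs_src[OF w] by (auto simp: ww src_def)
  note spv = sp_arc[OF v(1)]
  show ?thesis
  proof (cases qs)
    case Nil
    have "((u, ps @ [sp v]), (head G (sp v), [])) \<in> B l (head G (sp v))"
      using w spv v(1) unfolding ww Nil by (intro adm_pairs_extend) auto
    then show ?thesis using spv v by (simp add: ww Nil eq)
  next
    case (Cons b bs)
    note b = adm_pairs_pop[OF w[unfolded ww Cons]]
    have sw: "((u, butlast ps @ [sp v]), (head G (sp v), [])) \<in> B l (head G (sp v))"
      if c: "bs = [] \<and> ps \<noteq> [] \<and> last ps = b"
      by (rule adm_pairs_swap[OF w[unfolded ww Cons] c spv tail_sp[OF v(1)]])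
    show ?thesis
    proof (cases "bs = [] \<and> ps \<noteq> [] \<and> last ps = b")
      case True
      then show ?thesis using sw b spv v by (simp add: ww Cons eq algebra_simps)
    next
      case False
      then have "bdry t w = t (head G b) ((u, ps), (head G b, bs)) (rsz_arrow G b)"
        for t :: "('a, 'b, 'k) leavitt_elem" by (auto simp: ww Cons)
      then show ?thesis using b by (simp add: eq)
    qed
  qed
qed

text \<open>For A-linearity, a acts on the arrow values of a functional through its coefficient at
  the start of the arrow. That vertex is also the component in which the differential lands, where a
  acts on e_i^\<sharp> by the same scalar.\<close>

lemma leavitt_diff_hom: "leavitt_diff G sp l \<in> left_module_hom A (L l) (L (l + 1) :: (('a, 'b, 'k::field) rsz, _) module)"
proof -
  have add: "leavitt_diff G sp l (x \<oplus>\<^bsub>L l\<^esub> y) = leavitt_diff G sp l x \<oplus>\<^bsub>L (l + 1)\<^esub> leavitt_diff G sp l y"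
    if "x \<in> carrier (L l)" "y \<in> carrier (L l)" for x y :: "('a, 'b, 'k) leavitt_elem"
  proof (rule leavitt_eqI[of _ sp "l + 1"])
    have xy: "x \<oplus>\<^bsub>L l\<^esub> y \<in> carrier (L l)"
      using that by (rule abelian_groupE(1)[OF leavitt_abelian_group])
    then show "leavitt_diff G sp l (x \<oplus>\<^bsub>L l\<^esub> y) \<in> carrier (L (l + 1))"
      by (rule leavitt_diff_closed)
    show "leavitt_diff G sp l x \<oplus>\<^bsub>L (l + 1)\<^esub> leavitt_diff G sp l y \<in> carrier (L (l + 1))"
      using that by (intro abelian_groupE(1)[OF leavitt_abelian_group] leavitt_diff_closed)
    fix i w and X :: "('a, 'b, 'k) rsz"
    assume i: "i \<in> verts G" "w \<in> B (l + 1) i" "X \<in> right_proj G i"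
    have "bdry (x \<oplus>\<^bsub>L l\<^esub> y) w = 1 * bdry x w + 1 * bdry y w"
      by (rule bdry_linear[OF i(2)]) (simp add: leavitt_apply right_proj_arrow)
    then show "leavitt_diff G sp l (x \<oplus>\<^bsub>L l\<^esub> y) i w X =
        (leavitt_diff G sp l x \<oplus>\<^bsub>L (l + 1)\<^esub> leavitt_diff G sp l y) i w X"
      using that xy i by (simp add: leavitt_diff_apply leavitt_apply(1) distrib_right)
  qed
  have smult: "leavitt_diff G sp l (a \<odot>\<^bsub>L l\<^esub> x) = a \<odot>\<^bsub>L (l + 1)\<^esub> leavitt_diff G sp l x"
    if a: "a \<in> carrier A" and x: "x \<in> carrier (L l)" for a and x :: "('a, 'b, 'k) leavitt_elem"
  proof (rule leavitt_eqI[of _ sp "l + 1"])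
    have ax: "a \<odot>\<^bsub>L l\<^esub> x \<in> carrier (L l)"
      using that by (rule left_module.lsmult_closed[OF leavitt_left_module])
    then show "leavitt_diff G sp l (a \<odot>\<^bsub>L l\<^esub> x) \<in> carrier (L (l + 1))"
      by (rule leavitt_diff_closed)
    show "a \<odot>\<^bsub>L (l + 1)\<^esub> leavitt_diff G sp l x \<in> carrier (L (l + 1))"
      using that by (intro left_module.lsmult_closed[OF leavitt_left_module] leavitt_diff_closed)
    fix i w and X :: "('a, 'b, 'k) rsz"
    assume i: "i \<in> verts G" "w \<in> B (l + 1) i" "X \<in> right_proj G i"
    have "bdry (a \<odot>\<^bsub>L l\<^esub> x) w = vcoeff a i * bdry x w + 0 * bdry x w"
    proof (rule bdry_linear[OF i(2)])
      fix \<alpha> z assume \<alpha>: "\<alpha> \<in> arcs G" "tail G \<alpha> = i" and z: "z \<in> B l (head G \<alpha>)"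
      have h: "head G \<alpha> \<in> verts G" using \<alpha> by simp
      \<comment> \<open>Radical square zero: in the product of \<alpha> with a, only the coefficient
        of a at the start of \<alpha> survives.\<close>
      have "rsz_arrow G \<alpha> \<otimes>\<^bsub>A\<^esub> a = rsz_scalar G (vcoeff a i) \<otimes>\<^bsub>A\<^esub> rsz_arrow G \<alpha>"
        using \<alpha> a
        by (intro rsz_eqI) (auto simp: coeff_mult coeff_rsz_arrow coeff_rsz_scalar rsz_arrow_closed
            rsz_scalar_closed monoid.m_closed[OF ring.axioms(2)[OF rsz_algebra_ring]])
      moreover have "x (head G \<alpha>) z (rsz_scalar G (vcoeff a i) \<otimes>\<^bsub>A\<^esub> rsz_arrow G \<alpha>) =
          vcoeff a i * x (head G \<alpha>) z (rsz_arrow G \<alpha>)"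
        using leavitt_component[OF x h z] right_proj_arrow[OF \<alpha>(1), where 'k='k]
        unfolding carrier_inj_module by blast
      ultimately show "(a \<odot>\<^bsub>L l\<^esub> x) (head G \<alpha>) z (rsz_arrow G \<alpha>) =
          vcoeff a i * x (head G \<alpha>) z (rsz_arrow G \<alpha>) + 0 * x (head G \<alpha>) z (rsz_arrow G \<alpha>)"
        using \<alpha> z h by (simp add: leavitt_apply(3) right_proj_arrow)
    qed
    then show "leavitt_diff G sp l (a \<odot>\<^bsub>L l\<^esub> x) i w X = (a \<odot>\<^bsub>L (l + 1)\<^esub> leavitt_diff G sp l x) i w X"
      using a x ax i
      by (simp add: leavitt_diff_apply leavitt_apply(3) right_proj_mult right_proj_carrier coeff_mult)
  qed
  show ?thesis
    unfolding left_module_hom_def using add smult by (auto simp: leavitt_diff_closed)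
qed

section \<open>Kernel and image of the differential\<close>

lemma leavitt_diff_arrow_zero:
  fixes x :: "('a, 'b, 'k::field) leavitt_elem"
  assumes "x \<in> carrier (L l)" "\<alpha> \<in> arcs G" "z \<in> B (l + 1) (head G \<alpha>)"
  shows "leavitt_diff G sp l x (head G \<alpha>) z (rsz_arrow G \<alpha>) = 0"
  using assms by (simp add: leavitt_diff_apply right_proj_arrow coeff_rsz_arrow)

text \<open>The equations \<open>bdry x w = 0\<close> form a triangular system. Those with trivial
  second path kill the coefficients of the exceptional case. In the others the correction term is
  such a coefficient, so they kill the remaining ones.\<close>

lemma leavitt_diff_eq_zero_iff:
  fixes x :: "('a, 'b, 'k::field) leavitt_elem"
  assumes x: "x \<in> carrier (L l)"
  shows "leavitt_diff G sp l x = \<zero>\<^bsub>L (l + 1)\<^esub> \<longleftrightarrow>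
    (\<forall>\<alpha>\<in>arcs G. \<forall>z\<in>B l (head G \<alpha>). x (head G \<alpha>) z (rsz_arrow G \<alpha>) = 0)"
proof
  assume eq: "leavitt_diff G sp l x = \<zero>\<^bsub>L (l + 1)\<^esub>"
  have zero: "bdry x w = 0" if w: "w \<in> B (l + 1) i" for w i
  proof -
    have i: "i \<in> verts G" using adm_pairs_src[OF w] by simp
    \<comment> \<open>Evaluating at e_i, whose coefficient at i is 1, isolates
      \<open>bdry x w\<close>.\<close>
    have "leavitt_diff G sp l x i w (rsz_vertex G i) = 0"
      unfolding eq using i w by (simp add: leavitt_apply right_proj_vertex)
    then show ?thesis
      using i w by (simp add: leavitt_diff_apply[OF x] right_proj_vertex coeff_rsz_vertex)
  qed
  show "\<forall>\<alpha>\<in>arcs G. \<forall>z\<in>B l (head G \<alpha>). x (head G \<alpha>) z (rsz_arrow G \<alpha>) = 0"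
  proof (intro ballI)
    fix \<alpha> z assume \<alpha>: "\<alpha> \<in> arcs G" and z: "z \<in> B l (head G \<alpha>)"
    obtain u ps v qs where zz: "z = ((u, ps), (v, qs))" by (cases z) auto
    have v: "v = head G \<alpha>" using z by (auto simp: zz adm_pairs_iff)
    show "x (head G \<alpha>) z (rsz_arrow G \<alpha>) = 0"
    proof (cases "folds \<alpha> ps qs")
      case True
      then obtain rs where ps: "ps = rs @ [\<alpha>]" "qs = []" "sp (tail G \<alpha>) = \<alpha>"
        by (metis folds_def append_butlast_last_id special_iff)
      have "bdry x ((u, rs), (tail G \<alpha>, [])) = 0"
        using z unfolding zz ps by (intro zero[OF adm_pairs_trunc])
      then show ?thesis by (simp add: zz ps v)
    next
      case False
      let ?j = "tail G \<alpha>"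
      have w: "((u, ps), (?j, \<alpha> # qs)) \<in> B (l + 1) ?j"
        using adm_pairs_push[OF \<alpha> z[unfolded zz] False] .
      \<comment> \<open>The correction term in \<open>bdry\<close> at the extended pair; it is
        itself the \<open>bdry\<close> value at the truncated pair with trivial second path, hence
        zero.\<close>
      have "x (head G (sp ?j)) ((u, butlast ps @ [sp ?j]), (head G (sp ?j), [])) (rsz_arrow G (sp ?j)) = 0"
        if c: "qs = [] \<and> ps \<noteq> [] \<and> last ps = \<alpha>"
      proof -
        have ps: "ps = butlast ps @ [\<alpha>]" using c by (metis append_butlast_last_id)
        have "((u, butlast ps), (?j, [])) \<in> B (l + 1) ?j"
          using z c ps unfolding zz by (intro adm_pairs_trunc) auto
        from zero[OF this] show ?thesis by simp
      qed
      then show ?thesis using zero[OF w] by (simp add: zz v split: if_splits)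
    qed
  qed
next
  assume zero: "\<forall>\<alpha>\<in>arcs G. \<forall>z\<in>B l (head G \<alpha>). x (head G \<alpha>) z (rsz_arrow G \<alpha>) = 0"
  show "leavitt_diff G sp l x = \<zero>\<^bsub>L (l + 1)\<^esub>"
  proof (rule leavitt_eqI[of _ sp "l + 1"])
    show "leavitt_diff G sp l x \<in> carrier (L (l + 1))" by (rule leavitt_diff_closed[OF x])
    show "\<zero>\<^bsub>L (l + 1)\<^esub> \<in> carrier (L (l + 1))" by (rule abelian_groupE(2)[OF leavitt_abelian_group])
    fix i w and X :: "('a, 'b, 'k) rsz"
    assume i: "i \<in> verts G" "w \<in> B (l + 1) i" "X \<in> right_proj G i"
    have "bdry x w = 0 * bdry x w + 0 * bdry x w"
      by (rule bdry_linear[OF i(2)]) (simp add: zero)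
    then show "leavitt_diff G sp l x i w X = \<zero>\<^bsub>L (l + 1)\<^esub> i w X"
      using i x by (simp add: leavitt_diff_apply leavitt_apply)
  qed
qed

text \<open>The hypothesis \<open>zero\<close> places y in the span of the e_i^\<sharp>\<zeta>_w.
  The preimage is written down by its arrow coefficients, and what has to be checked is that they
  have finite support and that \<open>bdry\<close> returns the coefficients of y.\<close>

lemma leavitt_diff_surj:
  fixes y :: "('a, 'b, 'k::field) leavitt_elem"
  assumes y: "y \<in> carrier (L (l + 1))"
    and zero: "\<forall>\<alpha>\<in>arcs G. \<forall>z\<in>B (l + 1) (head G \<alpha>). y (head G \<alpha>) z (rsz_arrow G \<alpha>) = 0"
  obtains x where "x \<in> carrier (L l)" "leavitt_diff G sp l x = y"
proof -
  \<comment> \<open>The coefficient of e_i^\<sharp>\<zeta>_w in y, with i recovered from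
    \<open>w\<close>, so that \<open>c\<close> depends on the pair only.\<close>
  define c :: "('a, 'b) qpath \<times> ('a, 'b) qpath \<Rightarrow> 'k" where "c w = y (src (snd w)) w (rsz_vertex G (src (snd w)))" for w
  define S where "S = (\<Union>i\<in>verts G. {w \<in> B (l + 1) i. y i w \<noteq> \<zero>\<^bsub>inj_module G i\<^esub>})"
  have finS: "finite S" using y by (auto simp: S_def carrier_leavitt)
  have cS: "w \<in> S" if "w \<in> B (l + 1) i" "c w \<noteq> 0" for w i
    using that adm_pairs_src[OF that(1)]
    by (auto simp: S_def c_def inj_module_simps right_proj_vertex)
  \<comment> \<open>The coefficient of \<alpha>^\<sharp>\<zeta>_z in the preimage. The first summand
    comes from the pair with \<alpha> put before q. It is dropped in the exceptional case, where
    that pair is not admissible and y has no meaningful value. The second comes from the truncated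
    pair with trivial second path, which feeds every arrow starting there, special or not.\<close>
  define b :: "('a, 'b) qpath \<times> ('a, 'b) qpath \<Rightarrow> 'b \<Rightarrow> 'k" where "b z \<alpha> = (case z of ((u, ps), (v, qs)) \<Rightarrow>
      (if folds \<alpha> ps qs then 0 else c ((u, ps), (tail G \<alpha>, \<alpha> # qs))) +
      (if qs = [] \<and> ps \<noteq> [] \<and> last ps = \<alpha> then c ((u, butlast ps), (tail G \<alpha>, [])) else 0))" for z \<alpha>
  \<comment> \<open>The coefficients at the e_i^\<sharp> do not affect the differential and are set
    to 0.\<close>
  define x where "x = (\<lambda>i\<in>verts G. \<lambda>z\<in>B l i. dual_comb i 0 (b z))"
  have fin_b: "finite {z \<in> B l (head G \<alpha>). b z \<alpha> \<noteq> 0}" if \<alpha>: "\<alpha> \<in> arcs G" for \<alpha>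
  proof -
    \<comment> \<open>For fixed \<alpha> these maps recover z from the pair feeding the first or the
      second summand of \<open>b\<close>, so the support lies in two images of the finite set
      \<open>S\<close>.\<close>
    let ?g = "\<lambda>w. (fst w, (head G \<alpha>, tl (snd (snd w))))"
    let ?g' = "\<lambda>w. ((fst (fst w), snd (fst w) @ [\<alpha>]), (head G \<alpha>, []))"
    have "z \<in> ?g ` S \<union> ?g' ` S" if z: "z \<in> B l (head G \<alpha>)" "b z \<alpha> \<noteq> 0" for z
    proof -
      obtain u ps v qs where zz: "z = ((u, ps), (v, qs))" by (cases z) auto
      have v: "v = head G \<alpha>" using z(1) by (auto simp: zz adm_pairs_iff)
      consider "\<not> folds \<alpha> ps qs" "c ((u, ps), (tail G \<alpha>, \<alpha> # qs)) \<noteq> 0"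
        | "qs = [] \<and> ps \<noteq> [] \<and> last ps = \<alpha>" "c ((u, butlast ps), (tail G \<alpha>, [])) \<noteq> 0"
        using z(2) by (cases "c ((u, ps), (tail G \<alpha>, \<alpha> # qs)) = 0") (auto simp: b_def zz split: if_splits)
      then show ?thesis
      proof cases
        case 1
        then have "((u, ps), (tail G \<alpha>, \<alpha> # qs)) \<in> S"
          using adm_pairs_push[OF \<alpha> z(1)[unfolded zz]] cS by blast
        then have "?g ((u, ps), (tail G \<alpha>, \<alpha> # qs)) \<in> ?g ` S" by (rule imageI)
        then show ?thesis by (simp add: zz v)
      next
        case 2
        then have ps: "butlast ps @ [\<alpha>] = ps" by (metis append_butlast_last_id)
        then have "((u, butlast ps), (tail G \<alpha>, [])) \<in> S"
          using adm_pairs_trunc[of u "butlast ps" \<alpha> v l "head G \<alpha>"] z(1) 2 cS by (auto simp: zz)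
        then show ?thesis
          using 2 ps by (intro UnI2 image_eqI[of _ _ "((u, butlast ps), (tail G \<alpha>, []))"]) (simp_all add: zz v)
      qed
    qed
    then have "{z \<in> B l (head G \<alpha>). b z \<alpha> \<noteq> 0} \<subseteq> ?g ` S \<union> ?g' ` S" by blast
    then show ?thesis by (rule finite_subset) (simp add: finS)
  qed
  have "finite {z \<in> B l i. dual_comb i 0 (b z) \<noteq> \<zero>\<^bsub>inj_module G i\<^esub>}" if i: "i \<in> verts G" for i
  proof (rule finite_subset)
    show "{z \<in> B l i. dual_comb i 0 (b z) \<noteq> \<zero>\<^bsub>inj_module G i\<^esub>} \<subseteq>
        (\<Union>\<alpha>\<in>{\<alpha> \<in> arcs G. head G \<alpha> = i}. {z \<in> B l (head G \<alpha>). b z \<alpha> \<noteq> 0})"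
    proof
      fix z assume z: "z \<in> {z \<in> B l i. dual_comb i 0 (b z) \<noteq> \<zero>\<^bsub>inj_module G i\<^esub>}"
      have "\<exists>\<alpha>\<in>{\<alpha> \<in> arcs G. head G \<alpha> = i}. b z \<alpha> \<noteq> 0"
      proof (rule ccontr)
        assume "\<not> ?thesis"
        then have "dual_comb i 0 (b z) = \<zero>\<^bsub>inj_module G i\<^esub>"
          by (auto simp: dual_comb_def inj_module_simps intro!: restrict_ext sum.neutral)
        then show False using z by simp
      qed
      then show "z \<in> (\<Union>\<alpha>\<in>{\<alpha> \<in> arcs G. head G \<alpha> = i}. {z \<in> B l (head G \<alpha>). b z \<alpha> \<noteq> 0})"
        using z by auto
    qed
  qed (use fin_b in auto)
  then have x: "x \<in> carrier (L l)"
    unfolding carrier_leavitt by (auto simp: x_def dual_comb_closed cong: conj_cong)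
  have xb: "x (head G \<alpha>) z (rsz_arrow G \<alpha>) = b z \<alpha>" if "\<alpha> \<in> arcs G" "z \<in> B l (head G \<alpha>)" for \<alpha> z
    using that by (simp add: x_def dual_comb_basis)
  have bdry_x: "bdry x w = c w" if w: "w \<in> B (l + 1) i" for w i
  proof -
    obtain u ps v qs where ww: "w = ((u, ps), (v, qs))" by (cases w) auto
    have v: "v \<in> verts G" using adm_pairs_src[OF w] by (auto simp: ww src_def)
    note spv = sp_arc[OF v]
    have sp_special: "special G sp (sp v)" using spv v by (simp add: special_iff)
    show ?thesis
    proof (cases qs)
      case Nil
      have "((u, ps @ [sp v]), (head G (sp v), [])) \<in> B l (head G (sp v))"
        using w spv v unfolding ww Nil by (intro adm_pairs_extend) auto
      then show ?thesis using spv v sp_special by (simp add: ww Nil xb b_def folds_def)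
    next
      case (Cons b' bs)
      note b' = adm_pairs_pop[OF w[unfolded ww Cons]]
      let ?c = "bs = [] \<and> ps \<noteq> [] \<and> last ps = b'"
      \<comment> \<open>The special arrow at v is in the exceptional case here, so only the second
        summand of \<open>b\<close> is present.\<close>
      have "x (head G (sp v)) ((u, butlast ps @ [sp v]), (head G (sp v), [])) (rsz_arrow G (sp v)) =
          c ((u, butlast ps), (v, []))" if c: ?c
      proof -
        have "((u, butlast ps @ [sp v]), (head G (sp v), [])) \<in> B l (head G (sp v))"
          by (rule adm_pairs_swap[OF w[unfolded ww Cons] c spv tail_sp[OF v]])
        then show ?thesis using spv v sp_special by (simp add: xb b_def folds_def)
      qed
      \<comment> \<open>The additional term equals the correction subtracted in \<open>bdry\<close>,
        so the difference of the two values is \<open>c w\<close>.\<close>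
      moreover have "x (head G b') ((u, ps), (head G b', bs)) (rsz_arrow G b') =
          c w + (if ?c then c ((u, butlast ps), (v, [])) else 0)"
        using b' by (simp add: xb b_def ww Cons)
      ultimately show ?thesis by (cases ?c) (auto simp: ww Cons)
    qed
  qed
  have "leavitt_diff G sp l x i w = y i w" if i: "i \<in> verts G" and w: "w \<in> B (l + 1) i" for i w
  proof (rule inj_module_eqI[OF i])
    show "leavitt_diff G sp l x i w \<in> carrier (inj_module G i)" "y i w \<in> carrier (inj_module G i)"
      using i w x y by (auto intro!: leavitt_component leavitt_diff_closed)
    show "leavitt_diff G sp l x i w (rsz_vertex G i) = y i w (rsz_vertex G i)"
      using i w adm_pairs_src[OF w] bdry_x[OF w]
      by (simp add: leavitt_diff_apply[OF x] right_proj_vertex coeff_rsz_vertex c_def)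
    fix \<alpha> assume "\<alpha> \<in> arcs G" "head G \<alpha> = i"
    then show "leavitt_diff G sp l x i w (rsz_arrow G \<alpha>) = y i w (rsz_arrow G \<alpha>)"
      using leavitt_diff_arrow_zero[OF x, of \<alpha> w] zero w by auto
  qed
  then have "leavitt_diff G sp l x = y"
    by (intro leavitt_eqI[OF leavitt_diff_closed[OF x] y]) simp
  with x show thesis by (rule that)
qed

end

section \<open>From exactness to vanishing cohomology\<close>

lemma (in comm_group) trivial_Mod_carrier: "trivial_group (G Mod carrier G)"
proof -
  have "Group.group (G Mod carrier G)"
    using abelian_FactGroup[OF subgroup_self] by (rule comm_group.axioms(2))
  moreover have "carrier (G Mod carrier G) \<subseteq> {\<one>\<^bsub>G Mod carrier G\<^esub>}"
    using coset_join2[OF _ subgroup_self] by (auto simp: carrier_FactGroup)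
  ultimately show ?thesis by (simp add: group.trivial_group_subset)
qed

text \<open>By exactness the subgroup divided out is the whole kernel, so the cohomology is an
  abelian group modulo itself.\<close>

lemma trivial_cohomology:
  assumes M: "abelian_group (M l)" "abelian_group (M (l + 1))"
    and d: "d l \<in> left_module_hom R (M l) (M (l + 1))"
    and exact: "d (l - 1) ` carrier (M (l - 1)) = a_kernel (M l) (M (l + 1)) (d l)"
  shows "trivial_group (cohomology M d l)"
proof -
  let ?K = "a_kernel (M l) (M (l + 1)) (d l)"
  let ?H = "(add_monoid (M l))\<lparr>carrier := ?K\<rparr>"
  have "abelian_group_hom (M l) (M (l + 1)) (d l)"
    using d by (intro abelian_group_homI M group_hom.intro group_hom_axioms.intro abelian_group.a_group)
      (auto simp: left_module_hom_def hom_def)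
  then have K: "subgroup ?K (add_monoid (M l))"
    by (intro additive_subgroup.a_subgroup abelian_group_hom.additive_subgroup_a_kernel)
  have comm: "x \<oplus>\<^bsub>M l\<^esub> y = y \<oplus>\<^bsub>M l\<^esub> x" if "x \<in> ?K" "y \<in> ?K" for x y
    using that unfolding a_kernel_def' by (blast intro: abelian_groupE(4)[OF M(1)])
  have "comm_group ?H"
    using subgroup.subgroup_is_group[OF K abelian_group.a_group[OF M(1)]]
    by (rule group.group_comm_groupI) (simp add: comm)
  then have "trivial_group (?H Mod carrier ?H)" by (rule comm_group.trivial_Mod_carrier)
  then show ?thesis by (simp add: cohomology_def exact)
qed

theorem proposition1p9:
  fixes Q :: "('v, 'a) pre_digraph" and sp :: "'v \<Rightarrow> 'a"
  assumes "fin_digraph Q"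
    and "no_sinks Q"
    and "special_choice Q sp"
  shows "acyclic_complex (rsz_algebra Q :: ('v, 'a, 'k::field) rsz ring)
    (leavitt_module Q sp) (leavitt_diff Q sp)"
proof -
  interpret special_quiver Q sp
    using assms by (intro special_quiver.intro special_quiver_axioms.intro)
  \<comment> \<open>An image has no arrow coefficients, and by the kernel criterion such elements
    are killed.\<close>
  have sq: "leavitt_diff Q sp (l + 1) (leavitt_diff Q sp l x) = \<zero>\<^bsub>L (l + 2)\<^esub>"
    if "x \<in> carrier (L l)" for l and x :: "('v, 'a, 'k) leavitt_elem"
    using leavitt_diff_eq_zero_iff[OF leavitt_diff_closed[OF that]] leavitt_diff_arrow_zero[OF that]
    by (simp add: add.assoc)
  have exact: "leavitt_diff Q sp (l - 1) ` carrier (L (l - 1)) =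
      a_kernel (L l) (L (l + 1)) (leavitt_diff Q sp l :: ('v, 'a, 'k) leavitt_elem \<Rightarrow> _)" for l
  proof (intro equalityI subsetI)
    fix y :: "('v, 'a, 'k) leavitt_elem"
    assume "y \<in> leavitt_diff Q sp (l - 1) ` carrier (L (l - 1))"
    then show "y \<in> a_kernel (L l) (L (l + 1)) (leavitt_diff Q sp l)"
      using sq[of _ "l - 1"] leavitt_diff_closed[of _ "l - 1"] by (auto simp: a_kernel_def' add.commute)
  next
    fix y :: "('v, 'a, 'k) leavitt_elem"
    assume "y \<in> a_kernel (L l) (L (l + 1)) (leavitt_diff Q sp l)"
    then have "y \<in> carrier (L l)" "leavitt_diff Q sp l y = \<zero>\<^bsub>L (l + 1)\<^esub>" by (auto simp: a_kernel_def')
    \<comment> \<open>For a cocycle the kernel criterion gives the vanishing of the arrow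
      coefficients that \<open>leavitt_diff_surj\<close> requires.\<close>
    then obtain x where "x \<in> carrier (L (l - 1))" "leavitt_diff Q sp (l - 1) x = y"
      using leavitt_diff_surj[of y "l - 1"] leavitt_diff_eq_zero_iff[of y l] by auto
    then show "y \<in> leavitt_diff Q sp (l - 1) ` carrier (L (l - 1))" by blast
  qed
  show ?thesis
    unfolding acyclic_complex_def cochain_complex_def
    using leavitt_left_module leavitt_diff_hom sq
      trivial_cohomology[where M = L and d = "leavitt_diff Q sp", OF leavitt_abelian_group
        leavitt_abelian_group leavitt_diff_hom exact]
    by blast
qed

end
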